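(* Let $(n_j)_{j\ge1}$ be a strictly increasing unbounded sequence of positive real numbers, let $a_j>0$ for $j\ge1$, and set $A(x)=\sum_{n_j\le x}a_j$. Suppose that $A(x)=\rho x+O(x^{\beta})$ as $x\to\infty$ for some $\rho>0$ and $0\le\beta<1$. Let $f(s)=\sum_{j=1}^\infty a_jn_j^{-s}$ for $\operatorname{Re}s>1$, extended by analytic continuation to $\operatorname{Re}s>\beta$, $s\neq1$. Suppose moreover that $n_{j+1}-n_j\gg\max\{a_j,a_{j+1}\}$, i.e. there is a constant $c>0$ with $n_{j+1}-n_j\ge c\max\{a_j,a_{j+1}\}$ for all $j\ge1$. Then, as $T\to\infty$, $$\frac1T\int_0^T\Bigl|f\Bigl(\frac{1+\beta}{2}+it\Bigr)\Bigr|^2\,dt=\sum_{n_j\le T^{\frac1{1-\beta}}}\frac{a_j^2}{n_j^{1+\beta}}+O\Biggl(\biggl(\sum_{n_j\le T^{\frac1{1-\beta}}}\frac{a_j^2}{n_j^{1+\beta}}\biggr)^{1/2}\Biggr).$$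
   Context: Under the hypothesis on $A$, the series $f(s)$ converges absolutely for $\operatorname{Re}s>1$, and $f(s)-\rho/(s-1)$ has an analytic continuation to the half-plane $\operatorname{Re}s>\beta$; $f$ denotes the continued function. *)

theory Defs
  imports "HOL-Complex_Analysis.Complex_Analysis" "HOL-Library.Landau_Symbols"
begin

text \<open>Sequences are indexed from 0, so \<open>a j\<close> and \<open>n j\<close> stand for
  $a_{j+1}$ and $n_{j+1}$.\<close>

definition summatory :: "(nat \<Rightarrow> real) \<Rightarrow> (nat \<Rightarrow> real) \<Rightarrow> real \<Rightarrow> real" where
  "summatory a n x = (\<Sum>j | n j \<le> x. a j)"

definition is_dirichlet_continuation ::
  "(nat \<Rightarrow> real) \<Rightarrow> (nat \<Rightarrow> real) \<Rightarrow> real \<Rightarrow> (complex \<Rightarrow> complex) \<Rightarrow> bool" where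
  "is_dirichlet_continuation a n \<beta> f \<longleftrightarrow>
     f holomorphic_on ({s. Re s > \<beta>} - {1}) \<and>
     (\<forall>s. Re s > 1 \<longrightarrow> (\<lambda>j. of_real (a j) * of_real (n j) powr (- s)) sums f s)"

text \<open>The domain is connected, so for \<open>\<beta> < 1\<close> the values on it do not depend on the choice.
  No existence assumption is built in: if no continuation existed, the value would be arbitrary.\<close>

definition dirichlet_continuation ::
  "(nat \<Rightarrow> real) \<Rightarrow> (nat \<Rightarrow> real) \<Rightarrow> real \<Rightarrow> complex \<Rightarrow> complex" where
  "dirichlet_continuation a n \<beta> = (SOME f. is_dirichlet_continuation a n \<beta> f)"

definition diagonal_sum :: "(nat \<Rightarrow> real) \<Rightarrow> (nat \<Rightarrow> real) \<Rightarrow> real \<Rightarrow> real \<Rightarrow> real" where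
  "diagonal_sum a n \<beta> T = (\<Sum>j | n j \<le> T powr (1 / (1 - \<beta>)). (a j)\<^sup>2 / n j powr (1 + \<beta>))"

end

theory Submission
  imports Defs
begin

text \<open>
  Put \<open>\<sigma> = (1 + \<beta>) / 2\<close>, \<open>N = T powr (1 / (1 - \<beta>))\<close> and \<open>R x = A x - \<rho> x\<close>. On the line
  \<open>Re s = \<sigma>\<close> the function \<open>f\<close> is approximated by the Dirichlet polynomial \<open>S\<close> with terms
  \<open>n\<^sub>j \<le> N\<close>, with an error whose mean square over \<open>[0, T]\<close> is \<open>O(1)\<close>: the tail is
  \<open>s \<integral> R x * x powr (- s - 1) dx\<close> up to bounded terms, and by orthogonality its mean square is
  \<open>O(T * N powr (\<beta> - 1))\<close>. The integral over \<open>x > N\<close> is discretised on a geometric grid, where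
  orthogonality is exact.

  The mean square of \<open>S\<close> is the diagonal sum plus an off-diagonal Hilbert-type form in the
  frequencies \<open>ln n\<^sub>j\<close>. Positivity of the Gram matrices of \<open>exp (- (\<delta>\<^sub>j \<plusminus> \<i> \<nu>\<^sub>j) t)\<close> on \<open>(0, \<infinity>)\<close>
  bounds this form by sums with nonnegative terms. With \<open>\<delta>\<^sub>j = a\<^sub>j / n\<^sub>j\<close> the gap condition makes these
  sums telescope, and they contribute only \<open>O(1)\<close> to the mean. The cross term is handled by
  Cauchy--Schwarz, which produces the square root.
\<close>

subsection \<open>A weighted Hilbert inequality\<close>

text \<open>On the right half-plane, which is convex, the derivative of \<open>exp (- z)\<close> has
  modulus at most 1, so the mean value bound applies. It later bounds the factor
  \<open>1 - exp (- (s * of_real \<eta>))\<close> linearly in the grid step.\<close>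

lemma norm_one_minus_exp_le:
  fixes z :: complex
  assumes "Re z \<ge> 0"
  shows "cmod (1 - exp (- z)) \<le> cmod z"
proof -
  have "cmod (exp (- z) - exp (- 0)) \<le> 1 * cmod (z - 0)"
  proof (rule field_differentiable_bound[where S = "{z. Re z \<ge> 0}"])
    show "convex {z. Re z \<ge> 0}"
      by (rule convex_halfspace_Re_ge)
    show "((\<lambda>z. exp (- z)) has_field_derivative - exp (- z)) (at z within {z. Re z \<ge> 0})"
      if "z \<in> {z. Re z \<ge> 0}" for z :: complex
      by (auto intro!: derivative_eq_intros)
  qed (use assms in auto)
  thus ?thesis by (simp add: norm_minus_commute)
qed

lemma of_real_norm_sum_sq:
  fixes b :: "'i \<Rightarrow> complex"
  shows "of_real ((cmod (\<Sum>j\<in>J. b j))\<^sup>2) = (\<Sum>j\<in>J. \<Sum>k\<in>J. b j * cnj (b k))"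
  by (simp only: complex_norm_square sum_product cnj_sum)

lemma has_integral_exp_real_line:
  fixes z :: complex
  assumes "z \<noteq> 0" "T \<ge> 0"
  shows "((\<lambda>t. exp (- (z * of_real t))) has_integral (1 - exp (- (z * of_real T))) / z) {0..T}"
proof -
  have "((\<lambda>t. exp (- (z * of_real t))) has_integral
      (- exp (- (z * of_real T)) / z) - (- exp (- (z * of_real 0)) / z)) {0..T}"
  proof (rule fundamental_theorem_of_calculus[OF assms(2)])
    fix t :: real
    have "((\<lambda>t. - exp (- (z * t)) / z) has_field_derivative exp (- (z * of_real t))) (at (of_real t))"
      using assms(1) by (auto intro!: derivative_eq_intros)
    from has_vector_derivative_real_field[OF this]
    show "((\<lambda>t. - exp (- (z * of_real t)) / z) has_vector_derivative exp (- (z * of_real t)))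
        (at t within {0..T})" .
  qed
  thus ?thesis by (simp add: diff_divide_distrib)
qed

text \<open>The Gram matrix of the functions \<open>exp (- w\<^sub>j t)\<close> in \<open>L\<^sup>2(0,\<infinity>)\<close>.\<close>

lemma cauchy_matrix_nonneg:
  fixes b w :: "'i \<Rightarrow> complex"
  assumes fin: "finite J" and w: "\<And>j. j \<in> J \<Longrightarrow> Re (w j) > 0"
  shows "0 \<le> Re (\<Sum>j\<in>J. \<Sum>k\<in>J. b j * cnj (b k) / (w j + cnj (w k)))"
proof -
  \<comment> \<open>Truncation at \<open>T\<close> gives the squared norm on \<open>{0..T}\<close>
    of the sum of \<open>b j * exp (- (w j * t))\<close>, an integral over a compact interval;
    nonnegativity survives the limit in \<open>T\<close>.\<close>
  define I where "I = (\<lambda>T::real. \<Sum>j\<in>J. \<Sum>k\<in>J.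
      b j * cnj (b k) * ((1 - exp (- ((w j + cnj (w k)) * of_real T))) / (w j + cnj (w k))))"
  have nz: "Re (w j + cnj (w k)) > 0" if "j \<in> J" "k \<in> J" for j k
    using w[OF that(1)] w[OF that(2)] by simp
  have pos: "0 \<le> Re (I T)" if "T \<ge> 0" for T
  proof -
    have "((\<lambda>t. \<Sum>j\<in>J. \<Sum>k\<in>J. b j * cnj (b k) * exp (- ((w j + cnj (w k)) * of_real t)))
        has_integral I T) {0..T}"
      unfolding I_def
    proof (intro has_integral_sum has_integral_mult_right has_integral_exp_real_line fin that)
      fix j k assume "j \<in> J" "k \<in> J"
      thus "w j + cnj (w k) \<noteq> 0" using nz[of j k] by force
    qed
    also have "(\<lambda>t. \<Sum>j\<in>J. \<Sum>k\<in>J. b j * cnj (b k) * exp (- ((w j + cnj (w k)) * of_real t)))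
        = (\<lambda>t. of_real ((cmod (\<Sum>j\<in>J. b j * exp (- (w j * of_real t))))\<^sup>2))"
      unfolding of_real_norm_sum_sq
      by (simp add: exp_cnj mult_exp_exp algebra_simps)
    finally have "((\<lambda>t. (cmod (\<Sum>j\<in>J. b j * exp (- (w j * of_real t))))\<^sup>2) has_integral Re (I T)) {0..T}"
      by (auto dest: has_integral_Re)
    thus ?thesis by (rule has_integral_nonneg) auto
  qed
  have "(I \<longlongrightarrow> (\<Sum>j\<in>J. \<Sum>k\<in>J. b j * cnj (b k) * ((1 - 0) / (w j + cnj (w k))))) at_top"
    unfolding I_def
  proof (intro tendsto_intros)
    fix j k assume jk: "j \<in> J" "k \<in> J"
    show "w j + cnj (w k) \<noteq> 0" using nz[OF jk] by force
    have "((\<lambda>T. exp (- (Re (w j + cnj (w k)) * T))) \<longlongrightarrow> 0) at_top"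
      using nz[OF jk] by real_asymp
    thus "((\<lambda>T. exp (- ((w j + cnj (w k)) * of_real T))) \<longlongrightarrow> 0) at_top"
      by (subst tendsto_norm_zero_iff[symmetric]) simp
  qed
  hence "((\<lambda>T. Re (I T)) \<longlongrightarrow> Re (\<Sum>j\<in>J. \<Sum>k\<in>J. b j * cnj (b k) / (w j + cnj (w k)))) at_top"
    by (intro tendsto_Re) simp
  thus ?thesis
    by (rule tendsto_lowerbound) (auto intro!: eventually_mono[OF eventually_ge_at_top[of 0]] pos)
qed

text \<open>Gram positivity with exponents \<open>\<delta> j + e * \<i> * \<nu> j\<close>, e = 1 and
  e = -1, bounds the form with smoothed kernel \<open>h\<close> by the form with kernel
  \<open>p\<close>. Replacing \<open>h\<close> by \<open>1 / \<mu>\<close> costs at most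
  \<open>d / (2 * \<mu>^2)\<close> per pair. The weights \<open>\<delta>\<close> stay free, so that
  they can be fitted to the gaps later.\<close>

lemma hilbert_inequality_weighted:
  fixes b :: "'i \<Rightarrow> complex" and \<nu> \<delta> :: "'i \<Rightarrow> real"
  assumes fin: "finite J" and inj: "inj_on \<nu> J" and \<delta>: "\<And>j. j \<in> J \<Longrightarrow> \<delta> j > 0"
  shows "\<bar>Im (\<Sum>j\<in>J. \<Sum>k\<in>J - {j}. b j * cnj (b k) / of_real (\<nu> j - \<nu> k))\<bar> \<le>
    (\<Sum>j\<in>J. (cmod (b j))\<^sup>2 / (2 * \<delta> j)) +
    3 * (\<Sum>j\<in>J. \<Sum>k\<in>J - {j}. cmod (b j) * cmod (b k) * \<delta> j / (\<nu> j - \<nu> k)\<^sup>2)"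
proof -
  define d where "d = (\<lambda>j k. \<delta> j + \<delta> k)"
  define \<mu> where "\<mu> = (\<lambda>j k. \<nu> j - \<nu> k)"
  define h where "h = (\<lambda>j k. \<mu> j k / ((d j k)\<^sup>2 + (\<mu> j k)\<^sup>2))"
  define p where "p = (\<lambda>j k. d j k / ((d j k)\<^sup>2 + (\<mu> j k)\<^sup>2))"
  define C where "C = (\<lambda>j k. b j * cnj (b k))"
  define H where "H = (\<Sum>j\<in>J. \<Sum>k\<in>J. C j k * of_real (h j k))"
  define P where "P = (\<Sum>j\<in>J. \<Sum>k\<in>J. C j k * of_real (p j k))"
  have d_pos: "d j k > 0" if "j \<in> J" "k \<in> J" for j k
    using \<delta>[OF that(1)] \<delta>[OF that(2)] by (simp add: d_def)
  have den: "(d j k)\<^sup>2 + (\<mu> j k)\<^sup>2 > 0" if "j \<in> J" "k \<in> J" for j k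
    using d_pos[OF that] by (intro add_pos_nonneg) auto
  have p_nonneg: "p j k \<ge> 0" if "j \<in> J" "k \<in> J" for j k
    using den[OF that] d_pos[OF that] by (simp add: p_def)
  have inv: "1 / Complex (d j k) (e * \<mu> j k) = of_real (p j k) - e * \<i> * of_real (h j k)"
    if "j \<in> J" "k \<in> J" "e = 1 \<or> e = -1" for j k e
    using that den[OF that(1,2)]
    by (auto simp: complex_eq_iff Re_divide Im_divide p_def h_def power2_eq_square)
  have "0 \<le> Re (P - e * \<i> * H)" if e: "e = 1 \<or> e = -1" for e :: real
  proof -
    have "0 \<le> Re (\<Sum>j\<in>J. \<Sum>k\<in>J. b j * cnj (b k) /
        (Complex (\<delta> j) (e * \<nu> j) + cnj (Complex (\<delta> k) (e * \<nu> k))))"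
      by (rule cauchy_matrix_nonneg) (use fin \<delta> in auto)
    also have "(\<Sum>j\<in>J. \<Sum>k\<in>J. b j * cnj (b k) /
        (Complex (\<delta> j) (e * \<nu> j) + cnj (Complex (\<delta> k) (e * \<nu> k))))
        = (\<Sum>j\<in>J. \<Sum>k\<in>J. C j k * (1 / Complex (d j k) (e * \<mu> j k)))"
      by (intro sum.cong refl)
         (auto simp: C_def d_def \<mu>_def Complex_eq algebra_simps intro!: arg_cong2[of _ _ _ _ "(/)"])
    also have "\<dots> = (\<Sum>j\<in>J. \<Sum>k\<in>J. C j k * (of_real (p j k) - e * \<i> * of_real (h j k)))"
      using inv[OF _ _ e] by (intro sum.cong refl) simp
    also have "\<dots> = P - e * \<i> * H"
      by (simp add: P_def H_def algebra_simps sum_subtractf sum_distrib_left)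
    finally show ?thesis .
  qed
  \<comment> \<open>Since Re (- e \<i> H) = e Im H, the two signs give a two-sided bound.\<close>
  from this[of 1] this[of "-1"] have "\<bar>Im H\<bar> \<le> Re P"
    by auto
  also have "Re P \<le> cmod P" by (rule complex_Re_le_cmod)
  also have "\<dots> \<le> (\<Sum>j\<in>J. \<Sum>k\<in>J. cmod (b j) * cmod (b k) * p j k)"
    unfolding P_def using p_nonneg
    by (intro sum_norm_le) (simp add: C_def norm_mult)
  also have "\<dots> = (\<Sum>j\<in>J. (cmod (b j))\<^sup>2 / (2 * \<delta> j) +
       (\<Sum>k\<in>J - {j}. cmod (b j) * cmod (b k) * p j k))"
  proof (rule sum.cong[OF refl])
    fix j assume j: "j \<in> J"
    have "p j j = 1 / (2 * \<delta> j)"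
      using \<delta>[OF j] by (simp add: p_def d_def \<mu>_def power2_eq_square)
    thus "(\<Sum>k\<in>J. cmod (b j) * cmod (b k) * p j k) = (cmod (b j))\<^sup>2 / (2 * \<delta> j) +
       (\<Sum>k\<in>J - {j}. cmod (b j) * cmod (b k) * p j k)"
      using j fin by (simp add: sum.remove[of J j] power2_eq_square)
  qed
  finally have H: "\<bar>Im H\<bar> \<le> (\<Sum>j\<in>J. (cmod (b j))\<^sup>2 / (2 * \<delta> j)) +
      (\<Sum>j\<in>J. \<Sum>k\<in>J - {j}. cmod (b j) * cmod (b k) * p j k)"
    by (simp add: sum.distrib)
  have H': "H = (\<Sum>j\<in>J. \<Sum>k\<in>J - {j}. C j k * of_real (h j k))"
    unfolding H_def
  proof (rule sum.cong[OF refl])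
    fix j assume "j \<in> J"
    from sum.remove[OF fin this, of "\<lambda>k. C j k * of_real (h j k)"]
    show "(\<Sum>k\<in>J. C j k * of_real (h j k)) = (\<Sum>k\<in>J - {j}. C j k * of_real (h j k))"
      by (simp add: h_def \<mu>_def)
  qed
  define H0 where "H0 = (\<Sum>j\<in>J. \<Sum>k\<in>J - {j}. C j k / of_real (\<mu> j k))"
  have \<mu>_nz: "\<mu> j k \<noteq> 0" if "j \<in> J" "k \<in> J - {j}" for j k
    using inj that by (auto simp: \<mu>_def inj_on_def)
  have "cmod (H0 - H) \<le> (\<Sum>j\<in>J. \<Sum>k\<in>J - {j}. cmod (b j) * cmod (b k) * (d j k / (2 * (\<mu> j k)\<^sup>2)))"
    unfolding H0_def H' sum_subtractf[symmetric]
  proof (intro sum_norm_le)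
    fix j k assume jk: "j \<in> J" "k \<in> J - {j}"
    have \<mu>0: "\<bar>\<mu> j k\<bar> > 0" using \<mu>_nz[OF jk] by simp
    have D: "(d j k)\<^sup>2 + (\<mu> j k)\<^sup>2 > 0" using den jk by auto
    have eq: "1 / \<mu> j k - h j k = (d j k)\<^sup>2 / (\<mu> j k * ((d j k)\<^sup>2 + (\<mu> j k)\<^sup>2))"
      using \<mu>_nz[OF jk] D by (simp add: h_def divide_simps power2_eq_square)
    have "\<bar>1 / \<mu> j k - h j k\<bar> = (d j k)\<^sup>2 / (\<bar>\<mu> j k\<bar> * ((d j k)\<^sup>2 + (\<mu> j k)\<^sup>2))"
      unfolding eq using D by (simp add: abs_mult)
    \<comment> \<open>The arithmetic-geometric mean inequality in the denominator leaves
      \<open>d\<close> to the first power, the same order as the bound used for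
      \<open>p\<close>.\<close>
    also have "\<dots> \<le> (d j k)\<^sup>2 / (\<bar>\<mu> j k\<bar> * (2 * d j k * \<bar>\<mu> j k\<bar>))"
    proof -
      have "2 * d j k * \<bar>\<mu> j k\<bar> \<le> (d j k)\<^sup>2 + (\<mu> j k)\<^sup>2"
        using sum_squares_bound[of "d j k" "\<bar>\<mu> j k\<bar>"] by simp
      thus ?thesis using \<mu>0 d_pos[of j k] jk D
        by (intro divide_left_mono mult_left_mono mult_pos_pos) auto
    qed
    also have "\<dots> = d j k / (2 * (\<mu> j k)\<^sup>2)"
      using d_pos[of j k] jk \<mu>0 by (simp add: power2_eq_square divide_simps)
    finally have *: "\<bar>1 / \<mu> j k - h j k\<bar> \<le> d j k / (2 * (\<mu> j k)\<^sup>2)" .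
    have "C j k / of_real (\<mu> j k) - C j k * of_real (h j k) = C j k * of_real (1 / \<mu> j k - h j k)"
      by (simp add: algebra_simps)
    hence "cmod (C j k / of_real (\<mu> j k) - C j k * of_real (h j k))
       = cmod (b j) * cmod (b k) * \<bar>1 / \<mu> j k - h j k\<bar>"
      by (simp only: norm_mult norm_of_real C_def complex_mod_cnj)
    also have "\<dots> \<le> cmod (b j) * cmod (b k) * (d j k / (2 * (\<mu> j k)\<^sup>2))"
      by (rule mult_left_mono[OF *]) simp
    finally show "cmod (C j k / of_real (\<mu> j k) - C j k * of_real (h j k)) \<le> \<dots>" .
  qed
  hence "\<bar>Im H0\<bar> \<le> \<bar>Im H\<bar> + (\<Sum>j\<in>J. \<Sum>k\<in>J - {j}. cmod (b j) * cmod (b k) * (d j k / (2 * (\<mu> j k)\<^sup>2)))"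
    using abs_Im_le_cmod[of "H0 - H"] by simp
  also note H
  also have "(\<Sum>j\<in>J. \<Sum>k\<in>J - {j}. cmod (b j) * cmod (b k) * p j k) \<le>
     (\<Sum>j\<in>J. \<Sum>k\<in>J - {j}. cmod (b j) * cmod (b k) * (d j k / (\<mu> j k)\<^sup>2))"
    unfolding p_def using d_pos den \<mu>_nz
    by (intro sum_mono mult_left_mono divide_left_mono) (auto intro!: mult_pos_pos less_imp_le)
  \<comment> \<open>The off-diagonal part of \<open>p\<close> and the passage from \<open>h\<close>
    to \<open>1 / \<mu>\<close>, which costs half as much, add up to 3/2. Splitting \<open>d\<close>
    into its two weights and interchanging j and k then doubles this to 3.\<close>
  also have "(\<Sum>j\<in>J. (cmod (b j))\<^sup>2 / (2 * \<delta> j)) +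
      (\<Sum>j\<in>J. \<Sum>k\<in>J - {j}. cmod (b j) * cmod (b k) * (d j k / (\<mu> j k)\<^sup>2)) +
      (\<Sum>j\<in>J. \<Sum>k\<in>J - {j}. cmod (b j) * cmod (b k) * (d j k / (2 * (\<mu> j k)\<^sup>2))) =
      (\<Sum>j\<in>J. (cmod (b j))\<^sup>2 / (2 * \<delta> j)) +
      3 / 2 * (\<Sum>j\<in>J. \<Sum>k\<in>J - {j}. cmod (b j) * cmod (b k) * (d j k / (\<mu> j k)\<^sup>2))"
  proof -
    have "(\<Sum>j\<in>J. \<Sum>k\<in>J - {j}. cmod (b j) * cmod (b k) * (d j k / (2 * (\<mu> j k)\<^sup>2))) =
        (\<Sum>j\<in>J. \<Sum>k\<in>J - {j}. cmod (b j) * cmod (b k) * (d j k / (\<mu> j k)\<^sup>2)) / 2"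
      by (simp add: sum_divide_distrib mult.commute)
    thus ?thesis by (simp del: times_divide_eq_right)
  qed
  also have "(\<Sum>j\<in>J. \<Sum>k\<in>J - {j}. cmod (b j) * cmod (b k) * (d j k / (\<mu> j k)\<^sup>2)) =
     (\<Sum>j\<in>J. \<Sum>k\<in>J - {j}. cmod (b j) * cmod (b k) * \<delta> j / (\<mu> j k)\<^sup>2) +
     (\<Sum>j\<in>J. \<Sum>k\<in>J - {j}. cmod (b j) * cmod (b k) * \<delta> k / (\<mu> j k)\<^sup>2)"
    by (simp add: d_def sum.distrib[symmetric] algebra_simps add_divide_distrib)
  also have "(\<Sum>j\<in>J. \<Sum>k\<in>J - {j}. cmod (b j) * cmod (b k) * \<delta> k / (\<mu> j k)\<^sup>2) =
     (\<Sum>j\<in>J. \<Sum>k\<in>J - {j}. cmod (b j) * cmod (b k) * \<delta> j / (\<mu> j k)\<^sup>2)"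
  proof -
    have "(\<Sum>j\<in>J. \<Sum>k\<in>J - {j}. g j k) = (\<Sum>j\<in>J. \<Sum>k\<in>J - {j}. g k j)" for g :: "'i \<Rightarrow> 'i \<Rightarrow> real"
    proof -
      have "(\<Sum>j\<in>J. \<Sum>k | k \<in> J \<and> k \<noteq> j. g j k) = (\<Sum>k\<in>J. \<Sum>j | j \<in> J \<and> k \<noteq> j. g j k)"
        by (rule sum.swap_restrict) (use fin in auto)
      moreover have "J - {j} = {k. k \<in> J \<and> k \<noteq> j}" "{k. k \<in> J \<and> j \<noteq> k} = {k. k \<in> J \<and> k \<noteq> j}" for j
        by auto
      ultimately show ?thesis by simp
    qed
    from this[of "\<lambda>j k. cmod (b j) * cmod (b k) * \<delta> k / (\<mu> j k)\<^sup>2"] show ?thesis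
      by (simp add: \<mu>_def power2_commute mult.commute mult.left_commute)
  qed
  finally show ?thesis by (simp add: H0_def C_def \<mu>_def)
qed

subsection \<open>Mean squares of exponential sums\<close>

lemma integral_norm_exp_sum_sq:
  fixes b :: "'i \<Rightarrow> complex" and \<nu> :: "'i \<Rightarrow> real"
  assumes fin: "finite J" and inj: "inj_on \<nu> J" and T: "T \<ge> 0"
  shows "integral {0..T} (\<lambda>t. (cmod (\<Sum>j\<in>J. b j * cis (- (t * \<nu> j))))\<^sup>2) =
    T * (\<Sum>j\<in>J. (cmod (b j))\<^sup>2) +
    Re (\<Sum>j\<in>J. \<Sum>k\<in>J - {j}. b j * cnj (b k) *
      ((1 - cis (- (T * (\<nu> j - \<nu> k)))) / (\<i> * of_real (\<nu> j - \<nu> k))))"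
proof -
  define D where "D = (\<lambda>j k. (1 - cis (- (T * (\<nu> j - \<nu> k)))) / (\<i> * of_real (\<nu> j - \<nu> k)))"
  have "((\<lambda>t. \<Sum>j\<in>J. (b j * cnj (b j)) + (\<Sum>k\<in>J - {j}. b j * cnj (b k) *
           exp (- (\<i> * of_real (\<nu> j - \<nu> k) * of_real t))))
      has_integral (\<Sum>j\<in>J. of_real T * (b j * cnj (b j)) + (\<Sum>k\<in>J - {j}. b j * cnj (b k) * D j k))) {0..T}"
  proof (intro has_integral_sum has_integral_add has_integral_mult_right)
    fix j assume j: "j \<in> J"
    show "((\<lambda>t. b j * cnj (b j)) has_integral of_real T * (b j * cnj (b j))) {0..T}"
      using has_integral_const_real[of "b j * cnj (b j)" 0 T] T by (simp add: scaleR_conv_of_real)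
    fix k assume k: "k \<in> J - {j}"
    hence "\<nu> j \<noteq> \<nu> k" using inj j by (auto simp: inj_on_def)
    hence "\<i> * of_real (\<nu> j - \<nu> k) \<noteq> 0" by simp
    from has_integral_exp_real_line[OF this T]
    show "((\<lambda>t. exp (- (\<i> * of_real (\<nu> j - \<nu> k) * of_real t))) has_integral D j k) {0..T}"
      by (simp add: D_def cis_conv_exp algebra_simps)
  qed (use fin in auto)
  also have "(\<lambda>t. \<Sum>j\<in>J. (b j * cnj (b j)) + (\<Sum>k\<in>J - {j}. b j * cnj (b k) *
           exp (- (\<i> * of_real (\<nu> j - \<nu> k) * of_real t))))
     = (\<lambda>t. of_real ((cmod (\<Sum>j\<in>J. b j * cis (- (t * \<nu> j))))\<^sup>2))"
  proof (rule ext)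
    fix t
    have *: "b j * cis (- (t * \<nu> j)) * cnj (b k * cis (- (t * \<nu> k))) =
        b j * cnj (b k) * exp (- (\<i> * of_real (\<nu> j - \<nu> k) * of_real t))" for j k
    proof -
      have "cis (- (t * \<nu> j)) * cis (t * \<nu> k) = exp (- (\<i> * of_real (\<nu> j - \<nu> k) * of_real t))"
        by (simp add: cis_conv_exp mult_exp_exp algebra_simps)
      moreover have "cnj (cis (- (t * \<nu> k))) = cis (t * \<nu> k)" by (simp add: cis_cnj)
      ultimately show ?thesis by (metis (no_types, opaque_lifting) complex_cnj_mult mult.assoc mult.left_commute)
    qed
    have "b j * cnj (b j) + (\<Sum>k\<in>J - {j}. b j * cnj (b k) *
           exp (- (\<i> * of_real (\<nu> j - \<nu> k) * of_real t))) =
         (\<Sum>k\<in>J. b j * cnj (b k) * exp (- (\<i> * of_real (\<nu> j - \<nu> k) * of_real t)))"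
      if "j \<in> J" for j
      using sum.remove[OF fin that, of "\<lambda>k. b j * cnj (b k) * exp (- (\<i> * of_real (\<nu> j - \<nu> k) * of_real t))"]
      by simp
    thus "(\<Sum>j\<in>J. (b j * cnj (b j)) + (\<Sum>k\<in>J - {j}. b j * cnj (b k) *
           exp (- (\<i> * of_real (\<nu> j - \<nu> k) * of_real t))))
       = of_real ((cmod (\<Sum>j\<in>J. b j * cis (- (t * \<nu> j))))\<^sup>2)"
      unfolding of_real_norm_sum_sq * 
      by (rule sum.cong[OF refl]) simp
  qed
  finally have "integral {0..T} (\<lambda>t. (cmod (\<Sum>j\<in>J. b j * cis (- (t * \<nu> j))))\<^sup>2) =
      Re (\<Sum>j\<in>J. of_real T * (b j * cnj (b j)) + (\<Sum>k\<in>J - {j}. b j * cnj (b k) * D j k))"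
    by (auto dest!: has_integral_Re)
  thus ?thesis
    by (simp add: sum.distrib D_def complex_norm_square[symmetric] sum_distrib_left del: of_real_power
       flip: of_real_power)
qed

text \<open>Integrating the off-diagonal terms gives a difference of two Hilbert forms, one for each
  endpoint. The form at \<open>T\<close> has coefficients rotated by
  \<open>cis (- (T * \<nu> j))\<close>, whose moduli are unchanged, so both obey one bound and the
  error is free of \<open>T\<close>.\<close>

lemma mean_square_exp_sum:
  fixes b :: "'i \<Rightarrow> complex" and \<nu> \<delta> :: "'i \<Rightarrow> real"
  assumes fin: "finite J" and inj: "inj_on \<nu> J" and \<delta>: "\<And>j. j \<in> J \<Longrightarrow> \<delta> j > 0" and T: "T \<ge> 0"
  shows "\<bar>integral {0..T} (\<lambda>t. (cmod (\<Sum>j\<in>J. b j * cis (- (t * \<nu> j))))\<^sup>2) -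
    T * (\<Sum>j\<in>J. (cmod (b j))\<^sup>2)\<bar> \<le>
    (\<Sum>j\<in>J. (cmod (b j))\<^sup>2 / \<delta> j) +
    6 * (\<Sum>j\<in>J. \<Sum>k\<in>J - {j}. cmod (b j) * cmod (b k) * \<delta> j / (\<nu> j - \<nu> k)\<^sup>2)"
proof -
  define H where "H = (\<lambda>b. \<Sum>j\<in>J. \<Sum>k\<in>J - {j}. b j * cnj (b k) / of_real (\<nu> j - \<nu> k))"
  define b' where "b' = (\<lambda>j. b j * cis (- (T * \<nu> j)))"
  have *: "b j * cnj (b k) * ((1 - cis (- (T * (\<nu> j - \<nu> k)))) / (\<i> * of_real (\<nu> j - \<nu> k))) =
     - \<i> * (b j * cnj (b k) / of_real (\<nu> j - \<nu> k)) + \<i> * (b' j * cnj (b' k) / of_real (\<nu> j - \<nu> k))" for j k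
  proof -
    have "b' j * cnj (b' k) = b j * cnj (b k) * (cis (- (T * \<nu> j)) * cis (T * \<nu> k))"
      by (simp add: b'_def cis_cnj)
    also have "\<dots> = b j * cnj (b k) * cis (- (T * (\<nu> j - \<nu> k)))"
      by (simp add: cis_mult algebra_simps)
    finally have "b' j * cnj (b' k) = \<dots>" .
    moreover have "C * ((1 - w) / (\<i> * x)) = - \<i> * (C / x) + \<i> * (C * w / x)" for C w x :: complex
      by (cases "x = 0") (simp_all add: field_simps)
    ultimately show ?thesis by simp
  qed
  have "integral {0..T} (\<lambda>t. (cmod (\<Sum>j\<in>J. b j * cis (- (t * \<nu> j))))\<^sup>2) -
      T * (\<Sum>j\<in>J. (cmod (b j))\<^sup>2) = Re (- \<i> * H b + \<i> * H b')"
    unfolding integral_norm_exp_sum_sq[OF fin inj T] * H_def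
    by (simp only: sum.distrib sum_distrib_left add_diff_cancel_left')
  also have "\<bar>\<dots>\<bar> \<le> \<bar>Im (H b)\<bar> + \<bar>Im (H b')\<bar>" by simp
  finally have le: "\<bar>integral {0..T} (\<lambda>t. (cmod (\<Sum>j\<in>J. b j * cis (- (t * \<nu> j))))\<^sup>2) -
      T * (\<Sum>j\<in>J. (cmod (b j))\<^sup>2)\<bar> \<le> \<bar>Im (H b)\<bar> + \<bar>Im (H b')\<bar>" .
  have "\<bar>Im (H u)\<bar> \<le> (\<Sum>j\<in>J. (cmod (b j))\<^sup>2 / (2 * \<delta> j)) +
      3 * (\<Sum>j\<in>J. \<Sum>k\<in>J - {j}. cmod (b j) * cmod (b k) * \<delta> j / (\<nu> j - \<nu> k)\<^sup>2)"
    if "\<And>j. cmod (u j) = cmod (b j)" for u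
    using hilbert_inequality_weighted[where b = u and \<delta> = \<delta>, OF fin inj] \<delta>
    unfolding H_def that by blast
  from this[of b] this[of b'] le
  have "\<bar>integral {0..T} (\<lambda>t. (cmod (\<Sum>j\<in>J. b j * cis (- (t * \<nu> j))))\<^sup>2) -
      T * (\<Sum>j\<in>J. (cmod (b j))\<^sup>2)\<bar> \<le> 2 * (\<Sum>j\<in>J. (cmod (b j))\<^sup>2 / (2 * \<delta> j)) +
      6 * (\<Sum>j\<in>J. \<Sum>k\<in>J - {j}. cmod (b j) * cmod (b k) * \<delta> j / (\<nu> j - \<nu> k)\<^sup>2)"
    by (simp add: b'_def norm_mult)
  also have "2 * (\<Sum>j\<in>J. (cmod (b j))\<^sup>2 / (2 * \<delta> j)) = (\<Sum>j\<in>J. (cmod (b j))\<^sup>2 / \<delta> j)"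
    by (simp add: sum_distrib_left)
  finally show ?thesis .
qed

subsection \<open>Sequences with large gaps\<close>

text \<open>As \<open>c * u k\<close> is at most the last increment of \<open>y\<close>, each term
  is at most a difference of consecutive values of \<open>1 / (c * y)\<close>, and these telescope.
  The first term has no predecessor and costs another \<open>1 / (c * y 0)\<close>, whence the
  2.\<close>

lemma sum_inverse_square_gaps:
  fixes u y :: "nat \<Rightarrow> real"
  assumes c: "c > 0" and y0: "y 0 > 0" and u0: "c * u 0 \<le> y 0"
    and mono: "\<And>k. k < m \<Longrightarrow> y k < y (Suc k)"
    and u: "\<And>k. k < m \<Longrightarrow> c * u (Suc k) \<le> y (Suc k) - y k"
  shows "(\<Sum>k\<le>m. u k / (y k)\<^sup>2) \<le> 2 / (c * y 0)"
proof -
  \<comment> \<open>The negative last summand is the telescoping remainder; the induction needs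
    it.\<close>
  have "y i > 0 \<and> (\<Sum>k\<le>i. u k / (y k)\<^sup>2) \<le> 2 / (c * y 0) - 1 / (c * y i)" if "i \<le> m" for i
    using that
  proof (induction i)
    case 0
    have "u 0 / (y 0)\<^sup>2 \<le> (y 0 / c) / (y 0)\<^sup>2"
      using u0 c by (intro divide_right_mono) (auto simp: field_simps)
    also have "\<dots> = 2 / (c * y 0) - 1 / (c * y 0)"
      using c y0 by (simp add: field_simps power2_eq_square)
    finally show ?case using y0 by simp
  next
    case (Suc i)
    hence IH: "y i > 0" "(\<Sum>k\<le>i. u k / (y k)\<^sup>2) \<le> 2 / (c * y 0) - 1 / (c * y i)" by auto
    have lt: "y i < y (Suc i)" using mono[of i] Suc.prems by simp
    hence pos: "y (Suc i) > 0" using IH(1) by linarith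
    have "u (Suc i) / (y (Suc i))\<^sup>2 \<le> ((y (Suc i) - y i) / c) / (y (Suc i))\<^sup>2"
      using u[of i] Suc.prems c by (intro divide_right_mono) (auto simp: field_simps)
    also have "\<dots> \<le> ((y (Suc i) - y i) / c) / (y i * y (Suc i))"
      using IH(1) lt pos c by (intro divide_left_mono) (auto simp: power2_eq_square intro!: mult_right_mono divide_nonneg_pos)
    also have "\<dots> = 1 / (c * y i) - 1 / (c * y (Suc i))"
      using IH(1) pos c by (simp add: field_simps)
    finally show ?case using IH pos by simp
  qed
  from this[of m] have "y m > 0" "(\<Sum>k\<le>m. u k / (y k)\<^sup>2) \<le> 2 / (c * y 0) - 1 / (c * y m)" by auto
  thus ?thesis using c by (smt (verit) divide_nonneg_nonneg mult_nonneg_nonneg)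
qed

text \<open>This is \<open>ln v \<le> v - 1\<close> at the quotient of the smaller by the larger
  number.\<close>

lemma diff_over_max_le_ln_diff:
  fixes p q :: real
  assumes "p > 0" "q > 0"
  shows "\<bar>p - q\<bar> / max p q \<le> \<bar>ln p - ln q\<bar>"
proof -
  have *: "(p - q) / p \<le> ln p - ln q" if "0 < q" "q \<le> p" for p q :: real
    using ln_le_minus_one[of "q / p"] that by (simp add: ln_div field_simps)
  show ?thesis
    using *[of q p] *[of p q] assms by (cases "q \<le> p") (auto simp: max_def)
qed

text \<open>If p and q differ by at least half their maximum, the logarithms differ by at least 1/2,
  which gives the factor 4. Otherwise p and q are comparable within a factor 2, and
  \<open>\<bar>p - q\<bar> / M\<close> replaces the logarithmic difference at the cost of 2 * 4 =
  8.\<close>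

lemma inverse_ln_diff_sq_bound:
  fixes p q \<sigma> :: real
  assumes pq: "p > 0" "q > 0" "p \<noteq> q" and \<sigma>: "0 \<le> \<sigma>" "\<sigma> \<le> 1"
  shows "q powr (- \<sigma>) / (ln p - ln q)\<^sup>2 \<le> 4 * q powr (- \<sigma>) + 8 * p powr (2 - \<sigma>) / (q - p)\<^sup>2"
proof -
  define M where "M = max p q"
  have M: "M > 0" "p \<le> M" "q \<le> M" using pq by (auto simp: M_def)
  have ln: "\<bar>p - q\<bar> / M \<le> \<bar>ln p - ln q\<bar>"
    unfolding M_def by (rule diff_over_max_le_ln_diff) (use pq in auto)
  have d: "\<bar>p - q\<bar> > 0" using pq by simp
  show ?thesis
  proof (cases "M \<le> 2 * \<bar>p - q\<bar>")
    case True
    hence "1 / 2 \<le> \<bar>p - q\<bar> / M" using M by (simp add: field_simps)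
    hence "1 / 2 \<le> \<bar>ln p - ln q\<bar>" using ln by linarith
    hence "(1 / 2)\<^sup>2 \<le> \<bar>ln p - ln q\<bar>\<^sup>2" by (intro power_mono) auto
    hence "1 / 4 \<le> (ln p - ln q)\<^sup>2" by (simp add: power2_eq_square)
    hence "q powr (- \<sigma>) / (ln p - ln q)\<^sup>2 \<le> q powr (- \<sigma>) / (1 / 4)"
      by (intro divide_left_mono) (auto intro!: mult_pos_pos intro: less_le_trans[of _ "1/4"])
    moreover have "8 * p powr (2 - \<sigma>) / (q - p)\<^sup>2 \<ge> 0" by simp
    ultimately show ?thesis by (simp only: divide_divide_eq_right div_by_1 mult.commute)
  next
    case False
    hence *: "M \<le> 2 * p" "p / 2 \<le> q" using M pq by (auto simp: M_def max_def abs_if split: if_splits)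
    have "(\<bar>p - q\<bar> / M)\<^sup>2 \<le> \<bar>ln p - ln q\<bar>\<^sup>2"
      using ln M by (intro power_mono) auto
    hence 1: "(p - q)\<^sup>2 / M\<^sup>2 \<le> (ln p - ln q)\<^sup>2" by (simp add: power_divide)
    have "q powr (- \<sigma>) / (ln p - ln q)\<^sup>2 \<le> q powr (- \<sigma>) / ((p - q)\<^sup>2 / M\<^sup>2)"
      using 1 M d pq by (intro divide_left_mono) (auto intro!: mult_pos_pos divide_pos_pos)
    also have "\<dots> = q powr (- \<sigma>) * M\<^sup>2 / (q - p)\<^sup>2" by (simp add: power2_commute)
    also have "\<dots> \<le> (2 * p powr (- \<sigma>)) * (4 * p\<^sup>2) / (q - p)\<^sup>2"
    proof (intro divide_right_mono mult_mono)
      have "q powr (- \<sigma>) \<le> (p / 2) powr (- \<sigma>)"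
        using * pq \<sigma> by (intro powr_mono2') auto
      also have "\<dots> = 2 powr \<sigma> * p powr (- \<sigma>)"
        using pq by (simp add: powr_divide powr_minus_divide)
      also have "\<dots> \<le> 2 powr 1 * p powr (- \<sigma>)"
        using \<sigma> by (intro mult_right_mono powr_mono) auto
      finally show "q powr (- \<sigma>) \<le> 2 * p powr (- \<sigma>)" by simp
      have "M\<^sup>2 \<le> (2 * p)\<^sup>2" using * M by (intro power_mono) auto
      thus "M\<^sup>2 \<le> 4 * p\<^sup>2" by (simp add: power_mult_distrib)
    qed auto
    also have "\<dots> = 8 * (p powr (- \<sigma>) * p powr 2) / (q - p)\<^sup>2"
      using pq by (simp add: powr_numeral)
    also have "p powr (- \<sigma>) * p powr 2 = p powr (2 - \<sigma>)"
      by (simp add: powr_add[symmetric])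
    finally show ?thesis by (smt (verit) powr_ge_zero)
  qed
qed

section \<open>Consequences of the gap condition\<close>

locale gap_sequence =
  fixes n a :: "nat \<Rightarrow> real" and c :: real
  assumes n_pos: "\<And>j. n j > 0"
    and n_strict: "strict_mono n"
    and n_unbounded: "\<not> bdd_above (range n)"
    and a_pos: "\<And>j. a j > 0"
    and c_pos: "c > 0"
    and gap: "\<And>j. n (Suc j) - n j \<ge> c * max (a j) (a (Suc j))"
begin

lemma n_less_iff [simp]: "n i < n j \<longleftrightarrow> i < j"
  by (rule strict_mono_less[OF n_strict])

lemma n_le_iff [simp]: "n i \<le> n j \<longleftrightarrow> i \<le> j"
  by (rule strict_mono_less_eq[OF n_strict])

lemma n_eq_iff [simp]: "n i = n j \<longleftrightarrow> i = j"
  by (rule strict_mono_eq[OF n_strict])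

lemma gap_left: "c * a j \<le> n (Suc j) - n j"
  using gap[of j] c_pos by (smt (verit) max.cobounded1 mult_left_mono)

lemma gap_right: "c * a (Suc j) \<le> n (Suc j) - n j"
  using gap[of j] c_pos by (smt (verit) max.cobounded2 mult_left_mono)

lemma ex_n_greater: "\<exists>k. x < n k"
  using n_unbounded by (force simp: bdd_above_def not_le)

text \<open>The initial segment ends before the least index whose term exceeds \<open>x\<close>. It
  provides finiteness of the sums over \<open>n j \<le> x\<close> and allows induction on the last
  index.\<close>

lemma index_set_eq: "\<exists>m. {j. n j \<le> x} = {..<m}"
proof -
  obtain k where k: "x < n k" using ex_n_greater by blast
  define m where "m = (LEAST k. x < n k)"
  have "x < n m" unfolding m_def using k by (rule LeastI)
  hence "j < m" if "n j \<le> x" for j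
    using that n_less_iff[of j m] by linarith
  moreover have "n j \<le> x" if "j < m" for j
    using not_less_Least[of j "\<lambda>k. x < n k"] that by (simp add: m_def)
  ultimately have "{j. n j \<le> x} = {..<m}" by blast
  thus ?thesis by (rule exI)
qed

lemma finite_index_set [simp, intro]: "finite {j. n j \<le> x}"
proof -
  obtain m where "{j. n j \<le> x} = {..<m}" using index_set_eq by blast
  thus ?thesis by (simp only: finite_lessThan)
qed

lemma n_at_top: "filterlim n at_top sequentially"
  unfolding filterlim_at_top
proof
  fix Z
  obtain k where "Z < n k" using ex_n_greater by blast
  thus "\<forall>\<^sub>F j in sequentially. Z \<le> n j"
    by (intro eventually_sequentiallyI[of k]) (meson n_le_iff less_le_trans less_imp_le)
qed

text \<open>For j > 0 the gap before \<open>n j\<close> bounds \<open>a j\<close> by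
  \<open>n j / c\<close>. The initial term has no gap before it and contributes
  \<open>a 0 / n 0\<close>; adding the two constants covers both cases.\<close>

lemma a_le_n: "a j \<le> (a 0 / n 0 + 1 / c) * n j"
proof (cases j)
  case 0
  thus ?thesis using n_pos[of 0] c_pos by (simp add: algebra_simps)
next
  case (Suc i)
  have "a j \<le> (n (Suc i) - n i) / c" using gap_right[of i] c_pos Suc by (simp add: field_simps)
  also have "\<dots> \<le> n j / c" using n_pos[of i] c_pos Suc by (intro divide_right_mono) auto
  also have "\<dots> \<le> (a 0 / n 0 + 1 / c) * n j"
    using n_pos[of 0] n_pos[of j] a_pos[of 0] by (simp add: algebra_simps)
  finally show ?thesis .
qed

text \<open>On each side of j the distances to \<open>n j\<close> form a sequence to which
  \<open>sum_inverse_square_gaps\<close> applies. Both halves of the maximum in the gap condition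
  enter: one bounds the coefficients \<open>a k\<close> by the increments, the other bounds the
  nearest distance below by \<open>c * a j\<close>. Each side gives
  \<open>2 / (c^2 * a j)\<close>.\<close>

lemma sum_inverse_square_n:
  assumes fin: "finite J"
  shows "(\<Sum>k\<in>J - {j}. a k / (n k - n j)\<^sup>2) \<le> 4 / (c\<^sup>2 * a j)"
proof -
  obtain m where m: "J \<subseteq> {..m}" using fin finite_nat_iff_bounded_le by blast
  define g where "g = (\<lambda>k. a k / (n k - n j)\<^sup>2)"
  have g: "g k \<ge> 0" for k using a_pos[of k] by (simp add: g_def)
  have fraction: "2 / (c * y) \<le> 2 / (c\<^sup>2 * a j)" if "c * a j \<le> y" for y
    using that c_pos a_pos[of j]
    by (intro divide_left_mono) (auto simp: power2_eq_square intro!: mult_pos_pos intro: less_le_trans[of _ "c * a j"])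
  have "sum g (J - {j}) \<le> sum g ({..<j} \<union> {Suc j..Suc j + m})"
    using m g by (intro sum_mono2) auto
  also have "\<dots> = sum g {..<j} + sum g {Suc j..Suc j + m}"
    by (rule sum.union_disjoint) auto
  also have "sum g {Suc j..Suc j + m} = (\<Sum>k\<le>m. a (Suc j + k) / (n (Suc j + k) - n j)\<^sup>2)"
    using sum.shift_bounds_cl_nat_ivl[of g 0 "Suc j" m]
    by (simp add: g_def atMost_atLeast0 add.commute)
  also have "\<dots> \<le> 2 / (c * (n (Suc j + 0) - n j))"
    by (rule sum_inverse_square_gaps) (use c_pos in \<open>auto intro: gap_right\<close>)
  also have "\<dots> \<le> 2 / (c\<^sup>2 * a j)"
    by (rule fraction) (use gap_left[of j] in simp)
  also have "sum g {..<j} \<le> 2 / (c\<^sup>2 * a j)"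
  proof (cases j)
    case 0
    thus ?thesis using c_pos a_pos[of 0] by simp
  next
    case (Suc p)
    \<comment> \<open>Counting down from j - 1 makes the distances to the left of \<open>n j\<close>
      increase.\<close>
    have "sum g {..<j} = (\<Sum>k\<le>p. g (p - k))"
      unfolding Suc lessThan_Suc_atMost
      by (rule sum.reindex_bij_witness[of _ "\<lambda>k. p - k" "\<lambda>k. p - k"]) auto
    also have "\<dots> = (\<Sum>k\<le>p. a (p - k) / (n j - n (p - k))\<^sup>2)"
      by (simp add: g_def power2_commute)
    also have "\<dots> \<le> 2 / (c * (n j - n (p - 0)))"
    proof (rule sum_inverse_square_gaps)
      fix k assume k: "k < p"
      hence eq: "Suc (p - Suc k) = p - k" by simp
      show "c * a (p - Suc k) \<le> n j - n (p - Suc k) - (n j - n (p - k))"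
        using gap_left[of "p - Suc k"] by (simp add: eq)
    qed (use c_pos Suc gap_left[of p] in auto)
    also have "\<dots> \<le> 2 / (c\<^sup>2 * a j)"
      by (rule fraction) (use gap_right[of p] Suc in simp)
    finally show ?thesis .
  qed
  finally show ?thesis by (simp add: g_def mult.commute)
qed

text \<open>Since \<open>a j\<close> is at most the preceding gap divided by \<open>c\<close>, the
  sum from the second term on is bounded by a lower Riemann sum for the integral of
  \<open>v powr (- \<theta>)\<close>, up to the factor \<open>1 / c\<close>. The first term equals
  \<open>(a 0 / n 0) * n 0 powr (1 - \<theta>)\<close> and is kept separately.\<close>

lemma weighted_sum_bound:
  assumes \<theta>: "0 \<le> \<theta>" "\<theta> < 1" and x: "x > 0"
  shows "(\<Sum>j | n j \<le> x. a j * n j powr (- \<theta>)) \<le>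
    (a 0 / n 0 + 1 / (c * (1 - \<theta>))) * x powr (1 - \<theta>)"
proof -
  obtain m where m: "{j. n j \<le> x} = {..<m}" using index_set_eq by blast
  have step: "(q - p) * q powr (- \<theta>) \<le> (q powr (1 - \<theta>) - p powr (1 - \<theta>)) / (1 - \<theta>)"
    if pq: "0 < p" "p < q" for p q :: real
  proof -
    have "\<exists>z. p < z \<and> z < q \<and>
        q powr (1 - \<theta>) - p powr (1 - \<theta>) = (q - p) * ((1 - \<theta>) * z powr (- \<theta>))"
      using pq by (intro MVT2) (auto intro!: derivative_eq_intros)
    then obtain z where z: "p < z" "z < q"
      "q powr (1 - \<theta>) - p powr (1 - \<theta>) = (q - p) * ((1 - \<theta>) * z powr (- \<theta>))" by blast
    have "q powr (- \<theta>) \<le> z powr (- \<theta>)" using z pq \<theta> by (intro powr_mono2') auto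
    hence "(q - p) * q powr (- \<theta>) \<le> (q - p) * z powr (- \<theta>)" using pq by (intro mult_left_mono) auto
    thus ?thesis using z(3) \<theta> by simp
  qed
  have main: "(\<Sum>j\<le>i. a j * n j powr (- \<theta>)) \<le>
      (a 0 / n 0) * n 0 powr (1 - \<theta>) + (n i powr (1 - \<theta>) - n 0 powr (1 - \<theta>)) / (c * (1 - \<theta>))" for i
  proof (induction i)
    case 0
    have "n 0 powr (1 - \<theta>) = n 0 * n 0 powr (- \<theta>)"
      using n_pos[of 0] by (simp add: powr_diff powr_minus_divide)
    thus ?case using n_pos[of 0] by simp
  next
    case (Suc i)
    have "a (Suc i) * n (Suc i) powr (- \<theta>) \<le> (n (Suc i) - n i) / c * n (Suc i) powr (- \<theta>)"
      using gap_right[of i] c_pos by (intro mult_right_mono) (auto simp: field_simps)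
    also have "\<dots> = (n (Suc i) - n i) * n (Suc i) powr (- \<theta>) / c" by simp
    also have "\<dots> \<le> (n (Suc i) powr (1 - \<theta>) - n i powr (1 - \<theta>)) / (1 - \<theta>) / c"
      using step[of "n i" "n (Suc i)"] n_pos[of i] c_pos by (intro divide_right_mono) auto
    finally show ?case using Suc.IH by (simp add: diff_divide_distrib mult.commute)
  qed
  show ?thesis
  proof (cases m)
    case 0
    thus ?thesis using m \<theta> c_pos n_pos[of 0] a_pos[of 0] by simp
  next
    case (Suc i)
    hence ni: "n i \<le> x" using m by auto
    have "(\<Sum>j | n j \<le> x. a j * n j powr (- \<theta>)) = (\<Sum>j\<le>i. a j * n j powr (- \<theta>))"
      by (simp add: m Suc lessThan_Suc_atMost)
    also note main[of i]
    also have "(a 0 / n 0) * n 0 powr (1 - \<theta>) + (n i powr (1 - \<theta>) - n 0 powr (1 - \<theta>)) / (c * (1 - \<theta>))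
       \<le> (a 0 / n 0) * x powr (1 - \<theta>) + x powr (1 - \<theta>) / (c * (1 - \<theta>))"
    proof (intro add_mono mult_left_mono divide_right_mono)
      have "n 0 \<le> n i" by simp
      hence "n 0 \<le> x" using ni by linarith
      thus "n 0 powr (1 - \<theta>) \<le> x powr (1 - \<theta>)"
        using n_pos[of 0] \<theta> by (intro powr_mono2) auto
      have "n i powr (1 - \<theta>) \<le> x powr (1 - \<theta>)"
        using ni n_pos[of i] \<theta> by (intro powr_mono2) auto
      thus "n i powr (1 - \<theta>) - n 0 powr (1 - \<theta>) \<le> x powr (1 - \<theta>)" by (smt (verit) powr_ge_zero)
    qed (use n_pos[of 0] a_pos[of 0] c_pos \<theta> in auto)
    finally show ?thesis by (simp add: algebra_simps)
  qed
qed

text \<open>\<open>mean_square_exp_sum\<close> at the frequencies \<open>ln (n j)\<close> leaves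
  only error sums that the gap condition controls. The exponent is chosen by the application: for
  \<open>2 * \<sigma> = 1 + \<beta>\<close> and \<open>x = T powr (1 / (1 - \<beta>))\<close> the
  error is O(T).\<close>

lemma mean_square_dirichlet_polynomial:
  assumes \<sigma>: "1 / 2 \<le> \<sigma>" "\<sigma> < 1"
  shows "\<exists>C\<ge>0. \<forall>x>0. \<forall>T\<ge>0.
    \<bar>integral {0..T} (\<lambda>t. (cmod (\<Sum>j | n j \<le> x. of_real (a j * n j powr (- \<sigma>)) * cis (- (t * ln (n j)))))\<^sup>2) -
     T * (\<Sum>j | n j \<le> x. (a j)\<^sup>2 * n j powr (- (2 * \<sigma>)))\<bar> \<le> C * x powr (2 - 2 * \<sigma>)"
proof -
  define K where "K = (\<lambda>\<theta>. a 0 / n 0 + 1 / (c * (1 - \<theta>)))"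
  define K1 where "K1 = a 0 / n 0 + 1 / c"
  \<comment> \<open>\<open>K \<theta>\<close> is the constant of \<open>weighted_sum_bound\<close>.
    The first summand of \<open>C\<close> comes from the diagonal weights; inside the factor 6, the
    first term is the contribution of distant frequencies and the second that of close ones.\<close>
  define C where "C = K (2 * \<sigma> - 1) + 6 * (4 * K1 * (K \<sigma>)\<^sup>2 + 32 / c\<^sup>2 * K (2 * \<sigma> - 1))"
  have K1: "K1 > 0" using n_pos[of 0] a_pos[of 0] c_pos by (simp add: K1_def add_pos_pos)
  have K: "K \<theta> > 0" if "\<theta> < 1" for \<theta>
    using n_pos[of 0] a_pos[of 0] c_pos that by (simp add: K_def add_pos_pos)
  show ?thesis
  proof (intro exI[of _ C] conjI allI impI)
    show "C \<ge> 0" using K1 K[of \<sigma>] K[of "2 * \<sigma> - 1"] \<sigma> by (simp add: C_def)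
  next
    fix x T :: real assume x: "x > 0" and T: "T \<ge> 0"
    define J where "J = {j. n j \<le> x}"
    have fin: "finite J" by (simp add: J_def)
    define b where "b = (\<lambda>j. a j * n j powr (- \<sigma>))"
    \<comment> \<open>This weight turns \<open>(b j)^2 / \<delta> j\<close> into
      \<open>a j * n j powr (- (2 * \<sigma> - 1))\<close>, which \<open>weighted_sum_bound\<close>
      sums. Its factor \<open>a j\<close> also cancels the \<open>1 / a j\<close> produced by
      \<open>sum_inverse_square_n\<close>.\<close>
    define \<delta> where "\<delta> = (\<lambda>j. a j / n j)"
    have b: "b j > 0" for j using a_pos n_pos by (simp add: b_def order_less_imp_not_eq2)
    have sum1: "(\<Sum>j\<in>J. a j * n j powr (- (2 * \<sigma> - 1))) \<le> K (2 * \<sigma> - 1) * x powr (2 - 2 * \<sigma>)"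
      using weighted_sum_bound[of "2 * \<sigma> - 1" x] \<sigma> x by (simp add: J_def K_def)
    have sum2: "sum b J \<le> K \<sigma> * x powr (1 - \<sigma>)"
      using weighted_sum_bound[of \<sigma> x] \<sigma> x by (simp add: J_def K_def b_def)
    have diag: "(b j)\<^sup>2 / \<delta> j = a j * n j powr (- (2 * \<sigma> - 1))" for j
    proof -
      have "n j powr (- (2 * \<sigma> - 1)) = n j powr (- \<sigma>) * n j powr (- \<sigma>) * n j powr 1"
        by (simp only: powr_add[symmetric]) simp
      thus ?thesis using n_pos[of j] a_pos[of j]
        by (simp add: b_def \<delta>_def power2_eq_square field_simps)
    qed
    have bd: "b j * \<delta> j \<le> K1 * b j" for j
    proof -
      have "\<delta> j \<le> K1" using a_le_n[of j] n_pos[of j] by (simp add: \<delta>_def K1_def field_simps)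
      thus ?thesis using mult_left_mono[of "\<delta> j" K1 "b j"] b[of j] by (simp add: mult.commute)
    qed
    \<comment> \<open>Distant frequencies give a product of \<open>b j\<close> with the full sum of
      \<open>b\<close>, where \<open>\<delta> j \<le> K1\<close> suffices. Close ones give the
      constant 8 * 4 / c^2.\<close>
    have inner: "(\<Sum>k\<in>J - {j}. b j * b k * \<delta> j / (ln (n j) - ln (n k))\<^sup>2) \<le>
       4 * K1 * sum b J * b j + 32 / c\<^sup>2 * (a j * n j powr (- (2 * \<sigma> - 1)))" if j: "j \<in> J" for j
    proof -
      have "(\<Sum>k\<in>J - {j}. b j * b k * \<delta> j / (ln (n j) - ln (n k))\<^sup>2) =
         b j * \<delta> j * (\<Sum>k\<in>J - {j}. a k * (n k powr (- \<sigma>) / (ln (n j) - ln (n k))\<^sup>2))"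
        by (simp add: sum_distrib_left b_def mult_ac)
      also have "\<dots> \<le> b j * \<delta> j *
         (\<Sum>k\<in>J - {j}. a k * (4 * n k powr (- \<sigma>) + 8 * n j powr (2 - \<sigma>) / (n k - n j)\<^sup>2))"
        using b[of j] n_pos a_pos[THEN less_imp_le] \<sigma>
        by (intro mult_left_mono sum_mono inverse_ln_diff_sq_bound) (auto simp: \<delta>_def less_imp_le)
      also have "(\<Sum>k\<in>J - {j}. a k * (4 * n k powr (- \<sigma>) + 8 * n j powr (2 - \<sigma>) / (n k - n j)\<^sup>2)) =
         4 * sum b (J - {j}) + 8 * n j powr (2 - \<sigma>) * (\<Sum>k\<in>J - {j}. a k / (n k - n j)\<^sup>2)"
        by (simp add: sum_distrib_left b_def algebra_simps sum.distrib)
      also have "b j * \<delta> j * \<dots> \<le> b j * \<delta> j * (4 * sum b J + 8 * n j powr (2 - \<sigma>) * (4 / (c\<^sup>2 * a j)))"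
        using b n_pos[of j] a_pos[of j] fin
        by (intro mult_left_mono add_mono sum_inverse_square_n sum_mono2)
           (auto simp: \<delta>_def less_imp_le)
      also have "\<dots> = 4 * sum b J * (b j * \<delta> j) + 32 / c\<^sup>2 * (b j * \<delta> j * n j powr (2 - \<sigma>) / a j)"
        by (simp add: algebra_simps)
      also have "b j * \<delta> j * n j powr (2 - \<sigma>) / a j = a j * n j powr (- (2 * \<sigma> - 1))"
      proof -
        have "n j powr (- (2 * \<sigma> - 1)) = n j powr (- \<sigma>) * n j powr (2 - \<sigma>) * n j powr (-1)"
          by (simp only: powr_add[symmetric]) simp
        thus ?thesis using n_pos[of j] a_pos[of j]
          by (simp add: b_def \<delta>_def powr_minus_divide field_simps)
      qed
      also have "4 * sum b J * (b j * \<delta> j) \<le> 4 * sum b J * (K1 * b j)"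
        using bd[of j] b by (intro mult_left_mono) (auto intro!: sum_nonneg intro: less_imp_le)
      finally show ?thesis by (simp add: mult_ac)
    qed
    have sq: "(sum b J)\<^sup>2 \<le> (K \<sigma>)\<^sup>2 * x powr (2 - 2 * \<sigma>)"
    proof -
      have "(sum b J)\<^sup>2 \<le> (K \<sigma> * x powr (1 - \<sigma>))\<^sup>2"
        using sum2 b by (intro power_mono) (auto intro!: sum_nonneg intro: less_imp_le)
      also have "\<dots> = (K \<sigma>)\<^sup>2 * x powr (2 - 2 * \<sigma>)"
        by (simp add: power_mult_distrib power2_eq_square powr_add[symmetric])
      finally show ?thesis .
    qed
    have inj: "inj_on (\<lambda>j. ln (n j)) J" using n_pos by (auto simp: inj_on_def)
    have "\<bar>integral {0..T} (\<lambda>t. (cmod (\<Sum>j\<in>J. of_real (b j) * cis (- (t * ln (n j)))))\<^sup>2) -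
       T * (\<Sum>j\<in>J. (cmod (of_real (b j)))\<^sup>2)\<bar> \<le> (\<Sum>j\<in>J. (cmod (of_real (b j)))\<^sup>2 / \<delta> j) +
      6 * (\<Sum>j\<in>J. \<Sum>k\<in>J - {j}. cmod (of_real (b j)) * cmod (of_real (b k)) * \<delta> j / (ln (n j) - ln (n k))\<^sup>2)"
      using n_pos a_pos by (intro mean_square_exp_sum fin inj T) (simp add: \<delta>_def)
    also have "\<dots> = (\<Sum>j\<in>J. (b j)\<^sup>2 / \<delta> j) +
      6 * (\<Sum>j\<in>J. \<Sum>k\<in>J - {j}. b j * b k * \<delta> j / (ln (n j) - ln (n k))\<^sup>2)"
      using b by (simp add: less_imp_le)
    also have "\<dots> \<le> (\<Sum>j\<in>J. a j * n j powr (- (2 * \<sigma> - 1))) +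
      6 * (\<Sum>j\<in>J. 4 * K1 * sum b J * b j + 32 / c\<^sup>2 * (a j * n j powr (- (2 * \<sigma> - 1))))"
      using inner by (intro add_mono mult_left_mono sum_mono) (auto simp: diag)
    also have "\<dots> = (\<Sum>j\<in>J. a j * n j powr (- (2 * \<sigma> - 1))) +
      6 * (4 * K1 * (sum b J)\<^sup>2 + 32 / c\<^sup>2 * (\<Sum>j\<in>J. a j * n j powr (- (2 * \<sigma> - 1))))"
      by (simp add: sum.distrib sum_distrib_left[symmetric] power2_eq_square flip: sum_divide_distrib)
    also have "\<dots> \<le> K (2 * \<sigma> - 1) * x powr (2 - 2 * \<sigma>) +
      6 * (4 * K1 * ((K \<sigma>)\<^sup>2 * x powr (2 - 2 * \<sigma>)) + 32 / c\<^sup>2 * (K (2 * \<sigma> - 1) * x powr (2 - 2 * \<sigma>)))"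
      using sum1 sq K1 by (intro add_mono mult_left_mono) auto
    also have "\<dots> = C * x powr (2 - 2 * \<sigma>)" by (simp add: C_def algebra_simps)
    also have "(\<Sum>j\<in>J. (cmod (of_real (b j)))\<^sup>2) = (\<Sum>j\<in>J. (a j)\<^sup>2 * n j powr (- (2 * \<sigma>)))"
      by (intro sum.cong refl, simp only: norm_of_real power2_abs)
         (simp add: b_def power_mult_distrib power2_eq_square powr_add[symmetric])
    finally show "\<bar>integral {0..T} (\<lambda>t. (cmod (\<Sum>j | n j \<le> x. of_real (a j * n j powr (- \<sigma>)) * cis (- (t * ln (n j)))))\<^sup>2) -
     T * (\<Sum>j | n j \<le> x. (a j)\<^sup>2 * n j powr (- (2 * \<sigma>)))\<bar> \<le> C * x powr (2 - 2 * \<sigma>)"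
      unfolding J_def b_def .
  qed
qed

end

subsection \<open>Summation by parts on a geometric grid\<close>

lemma powr_of_real_exp: "x > 0 \<Longrightarrow> of_real x powr s = exp (s * of_real (ln x))" for x :: real and s :: complex
  by (simp add: powr_def Ln_of_real)

lemma norm_of_real_powr: "x > 0 \<Longrightarrow> cmod (of_real x powr s) = x powr Re s" for x :: real
  by (simp add: norm_powr_real_powr)

text \<open>Factoring out \<open>u powr (- s)\<close> leaves
  \<open>1 - exp (- (s * ln (y / u)))\<close>.\<close>

lemma norm_powr_minus_diff_le:
  fixes x u y :: real
  assumes xuy: "0 < x" "x \<le> u" "u \<le> y" and s: "Re s \<ge> 0"
  shows "cmod (of_real u powr (- s) - of_real y powr (- s)) \<le> cmod s * ln (y / x) * x powr (- Re s)"
proof -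
  define z where "z = s * of_real (ln (y / u))"
  have ln: "0 \<le> ln (y / u)" "ln (y / u) \<le> ln (y / x)" using xuy by (simp_all add: ln_div)
  have "of_real u powr (- s) - of_real y powr (- s) = of_real u powr (- s) * (1 - exp (- z))"
    using xuy by (simp add: powr_of_real_exp z_def ln_div algebra_simps mult_exp_exp)
  hence "cmod (of_real u powr (- s) - of_real y powr (- s)) = u powr (- Re s) * cmod (1 - exp (- z))"
    using xuy by (simp add: norm_mult norm_of_real_powr)
  also have "\<dots> \<le> x powr (- Re s) * (cmod s * ln (y / x))"
  proof (intro mult_mono)
    show "u powr (- Re s) \<le> x powr (- Re s)" using xuy s by (intro powr_mono2') auto
    have "cmod (1 - exp (- z)) \<le> cmod z" using s ln by (intro norm_one_minus_exp_le) (simp add: z_def)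
    also have "\<dots> \<le> cmod s * ln (y / x)" using ln by (simp add: z_def norm_mult mult_left_mono)
    finally show "cmod (1 - exp (- z)) \<le> cmod s * ln (y / x)" .
  qed auto
  finally show ?thesis by (simp add: mult_ac)
qed

text \<open>The left side is the modulus of the integral of
  \<open>v powr (- s) - y powr (- s)\<close> over \<open>{x..y}\<close>, whose integrand
  \<open>norm_powr_minus_diff_le\<close> bounds pointwise.\<close>

lemma powr_linearization_bound:
  fixes x y :: real
  assumes xy: "0 < x" "x \<le> y" and s: "Re s \<ge> 0" "s \<noteq> 1"
  shows "cmod ((of_real y powr (1 - s) - of_real x powr (1 - s)) / (1 - s) - of_real (y - x) * of_real y powr (- s))
    \<le> (y - x) * (cmod s * ln (y / x) * x powr (- Re s))"
proof -
  define g where "g = (\<lambda>v::real. of_real v powr (1 - s) / (1 - s))"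
  have "norm (g y - g x - (y - x) *\<^sub>R (of_real y powr (- s))) \<le> norm (y - x) * (cmod s * ln (y / x) * x powr (- Re s))"
  proof (rule vector_differentiable_bound_linearization[where f' = "\<lambda>v. of_real v powr (- s)" and S = "{x..y}"])
    fix v assume v: "v \<in> {x..y}"
    have "((\<lambda>w. w powr (1 - s) / (1 - s)) has_field_derivative of_real v powr (- s)) (at (of_real v))"
      using v xy s by (auto intro!: derivative_eq_intros simp: complex_nonpos_Reals_iff)
    from has_vector_derivative_real_field[OF this]
    show "(g has_vector_derivative of_real v powr (- s)) (at v within {x..y})" unfolding g_def .
    show "norm (of_real v powr (- s) - of_real y powr (- s)) \<le> cmod s * ln (y / x) * x powr (- Re s)"
      using v xy s by (intro norm_powr_minus_diff_le) auto
  qed (use xy in \<open>auto simp: closed_segment_eq_real_ivl\<close>)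
  thus ?thesis using xy by (simp add: g_def diff_divide_distrib scaleR_conv_of_real)
qed

text \<open>Up to the factor \<eta> this is a geometric series with ratio
  \<open>q = exp (- (\<alpha> * \<eta>))\<close>. It acts as a Riemann sum for the integral of
  \<open>y powr (- \<alpha> - 1)\<close> over \<open>y > N\<close>, so the bound stays finite as
  \<eta> tends to 0 and is uniform in \<open>K\<close>. The case \<eta> = 0 covers a grid with equal
  endpoints.\<close>

lemma geometric_powr_sum_bound:
  fixes N \<eta> \<alpha> :: real
  assumes N: "N > 0" and \<eta>: "\<eta> \<ge> 0" and \<alpha>: "\<alpha> > 0"
  shows "\<eta> * (\<Sum>m<K. (N * exp (real m * \<eta>)) powr (- \<alpha>)) \<le> (\<eta> + 1 / \<alpha>) * N powr (- \<alpha>)"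
proof (cases "\<eta> = 0")
  case False
  define q where "q = exp (- (\<alpha> * \<eta>))"
  have x: "\<alpha> * \<eta> > 0" using False \<eta> \<alpha> by simp
  have "q \<le> 1 / (1 + \<alpha> * \<eta>)"
    unfolding q_def exp_minus inverse_eq_divide using x exp_ge_add_one_self[of "\<alpha> * \<eta>"]
    by (intro divide_left_mono) auto
  also have "\<dots> = 1 - \<alpha> * \<eta> / (1 + \<alpha> * \<eta>)" using x by (simp add: field_simps)
  finally have q: "\<alpha> * \<eta> / (1 + \<alpha> * \<eta>) \<le> 1 - q" by simp
  have q01: "0 < q" "q < 1" using x by (simp_all add: q_def)
  have eq: "(N * exp (real m * \<eta>)) powr (- \<alpha>) = N powr (- \<alpha>) * q ^ m" for m
  proof -
    have "exp (real m * \<eta>) powr (- \<alpha>) = q ^ m"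
      by (simp add: powr_def q_def exp_of_nat_mult[symmetric] mult_ac)
    thus ?thesis using N by (simp add: powr_mult)
  qed
  have "(\<Sum>m<K. q ^ m) = (1 - q ^ K) / (1 - q)" using q01 by (subst sum_gp_strict) auto
  also have "\<dots> \<le> 1 / (1 - q)" using q01 by (intro divide_right_mono) auto
  also have "\<dots> \<le> 1 / (\<alpha> * \<eta> / (1 + \<alpha> * \<eta>))" using q x q01 by (intro divide_left_mono) auto
  finally have "\<eta> * (\<Sum>m<K. q ^ m) \<le> \<eta> * ((1 + \<alpha> * \<eta>) / (\<alpha> * \<eta>))"
    using \<eta> by (intro mult_left_mono) auto
  also have "\<dots> = \<eta> + 1 / \<alpha>" using False \<alpha> by (simp add: field_simps)
  finally have "\<eta> * (\<Sum>m<K. q ^ m) * N powr (- \<alpha>) \<le> (\<eta> + 1 / \<alpha>) * N powr (- \<alpha>)"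
    by (intro mult_right_mono) auto
  thus ?thesis unfolding eq sum_distrib_left[symmetric] by (simp add: mult_ac)
qed (use \<alpha> in simp)

section \<open>Partial sums corrected by the main term\<close>

locale dirichlet_series = gap_sequence +
  fixes \<rho> \<beta> :: real
  assumes rho: "\<rho> > 0"
    and beta: "0 \<le> \<beta>" "\<beta> < 1"
    and A_asymp: "(\<lambda>x. summatory a n x - \<rho> * x) \<in> O[at_top](\<lambda>x. x powr \<beta>)"
begin

abbreviation "A \<equiv> summatory a n"

definition R :: "real \<Rightarrow> real" where "R x = A x - \<rho> * x"

text \<open>For Re s > 1 the added term is the integral of \<open>\<rho> * v powr (- s)\<close> over
  \<open>v > x\<close>, the expected tail of the series. With this correction the partial sums
  converge for Re s > \<beta>.\<close>

definition F :: "complex \<Rightarrow> real \<Rightarrow> complex" where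
  "F s x = (\<Sum>j | n j \<le> x. of_real (a j) * of_real (n j) powr (- s)) +
     of_real \<rho> * of_real x powr (1 - s) / (s - 1)"

lemma remainder_bound:
  obtains C x0 where "C > 0" "x0 \<ge> 1" "\<And>x. x \<ge> x0 \<Longrightarrow> \<bar>R x\<bar> \<le> C * x powr \<beta>"
proof -
  obtain C where C: "C > 0" "eventually (\<lambda>x. norm (A x - \<rho> * x) \<le> C * norm (x powr \<beta>)) at_top"
    using A_asymp by (elim landau_o.bigE)
  then obtain x0 where "\<And>x. x \<ge> x0 \<Longrightarrow> \<bar>R x\<bar> \<le> C * x powr \<beta>"
    by (auto simp: eventually_at_top_linorder R_def)
  thus ?thesis using C(1) by (intro that[of C "max 1 x0"]) auto
qed

lemma A_mono: "x \<le> y \<Longrightarrow> A x \<le> A y"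
  unfolding summatory_def using a_pos by (intro sum_mono2) (auto intro: less_imp_le)

lemma index_set_Un: "x \<le> y \<Longrightarrow> {j. n j \<le> y} = {j. n j \<le> x} \<union> {j. x < n j \<and> n j \<le> y}"
  by auto

lemma finite_block [simp]: "finite {j. x < n j \<and> n j \<le> y}"
  by (rule finite_subset[of _ "{j. n j \<le> y}"]) auto

lemma sum_block:
  fixes h :: "nat \<Rightarrow> 'b :: ab_group_add"
  assumes "x \<le> y"
  shows "(\<Sum>j | n j \<le> y. h j) - (\<Sum>j | n j \<le> x. h j) = (\<Sum>j | x < n j \<and> n j \<le> y. h j)"
  unfolding index_set_Un[OF assms] by (subst sum.union_disjoint) auto

text \<open>The increment of \<open>F\<close> is the Stieltjes integral of
  \<open>v powr (- s)\<close> against R over the block. Freezing the integrand at the right endpoint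
  gives the main term; the error is estimated separately for the jumps of A and for the linear
  part.\<close>

lemma F_block:
  assumes xy: "0 < x" "x \<le> y" and s: "Re s \<ge> 0" "s \<noteq> 1"
  shows "cmod (F s y - F s x - of_real (R y - R x) * of_real y powr (- s)) \<le>
    cmod s * ln (y / x) * x powr (- Re s) * (A y - A x + \<rho> * (y - x))"
proof -
  define B where "B = cmod s * ln (y / x) * x powr (- Re s)"
  define S where "S = (\<Sum>j | x < n j \<and> n j \<le> y. of_real (a j) * (of_real (n j) powr (- s) - of_real y powr (- s)))"
  define I where "I = (of_real y powr (1 - s) - of_real x powr (1 - s)) / (1 - s) - of_real (y - x) * of_real y powr (- s)"
  have Adiff: "A y - A x = (\<Sum>j | x < n j \<and> n j \<le> y. a j)"
    unfolding summatory_def by (rule sum_block) fact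
  have "F s y - F s x = (\<Sum>j | x < n j \<and> n j \<le> y. of_real (a j) * of_real (n j) powr (- s)) -
      of_real \<rho> * ((of_real y powr (1 - s) - of_real x powr (1 - s)) / (1 - s))"
    unfolding sum_block[OF xy(2), symmetric] F_def using s(2)
    by (simp add: divide_simps) (simp add: algebra_simps)
  also have "(\<Sum>j | x < n j \<and> n j \<le> y. of_real (a j) * of_real (n j) powr (- s)) =
      S + of_real (A y - A x) * of_real y powr (- s)"
    unfolding Adiff S_def by (simp add: algebra_simps sum_subtractf sum_distrib_left)
  finally have "F s y - F s x - of_real (R y - R x) * of_real y powr (- s) = S - of_real \<rho> * I"
    by (simp add: R_def I_def algebra_simps)
  also have "cmod \<dots> \<le> cmod S + \<rho> * cmod I"
    using norm_triangle_ineq4[of S "of_real \<rho> * I"] rho by (simp add: norm_mult)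
  also have "cmod S \<le> (\<Sum>j | x < n j \<and> n j \<le> y. a j * B)"
    unfolding S_def B_def
  proof (intro sum_norm_le)
    fix j assume "j \<in> {j. x < n j \<and> n j \<le> y}"
    thus "cmod (of_real (a j) * (of_real (n j) powr (- s) - of_real y powr (- s)))
        \<le> a j * (cmod s * ln (y / x) * x powr (- Re s))"
      using norm_powr_minus_diff_le[of x "n j" y s] xy s a_pos[of j]
      by (simp add: norm_mult mult_left_mono)
  qed
  also have "\<dots> = B * (A y - A x)" by (simp add: Adiff sum_distrib_left mult.commute)
  also have "cmod I \<le> (y - x) * B"
    unfolding I_def B_def by (rule powr_linearization_bound) fact+
  finally show ?thesis using rho by (simp add: B_def algebra_simps)
qed

text \<open>Summation by parts over the geometric grid \<open>N exp (m \<eta>)\<close>, on which the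
  functions \<open>y powr (- \<i> t)\<close> are orthogonal over a period.\<close>

definition grid_sum :: "real \<Rightarrow> real \<Rightarrow> nat \<Rightarrow> complex \<Rightarrow> complex" where
  "grid_sum N \<eta> K s = (\<Sum>m<K. of_real (R (N * exp (real m * \<eta>))) * of_real (N * exp (real m * \<eta>)) powr (- s))"

text \<open>One grid step multiplies \<open>y powr (- s)\<close> by
  \<open>exp (- (s * \<eta>))\<close>, so each frozen increment of R equals
  \<open>r (Suc m) - r m\<close> plus \<open>(1 - exp (- (s * \<eta>))) * r m\<close>. The first
  part telescopes, the second has a common factor and leaves a grid sum. For fixed N and M the error
  vanishes as \<open>K\<close> grows.\<close>

lemma F_grid:
  assumes N: "0 < N" "N \<le> M" and K: "K > 0" and \<eta>: "\<eta> = ln (M / N) / real K"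
    and s: "Re s \<ge> 0" "s \<noteq> 1"
  shows "cmod (F s M - F s N - (of_real (R M) * of_real M powr (- s) - of_real (R N) * of_real N powr (- s) +
      (1 - exp (- (s * of_real \<eta>))) * grid_sum N \<eta> K s)) \<le>
    cmod s * \<eta> * N powr (- Re s) * (A M - A N + \<rho> * (M - N))"
proof -
  define y where "y = (\<lambda>m. N * exp (real m * \<eta>))"
  define r where "r = (\<lambda>m. of_real (R (y m)) * of_real (y m) powr (- s))"
  have \<eta>0: "\<eta> \<ge> 0" using N by (simp add: \<eta>)
  have y0: "y 0 = N" and yK: "y K = M" using N K by (simp_all add: y_def \<eta>)
  have y_pos: "y m > 0" for m using N by (simp add: y_def)
  have y_le: "N \<le> y m" for m using N \<eta>0 by (simp add: y_def)
  have y_Suc: "y (Suc m) = y m * exp \<eta>" for m by (simp add: y_def algebra_simps exp_add)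
  have ln_y: "ln (y (Suc m) / y m) = \<eta>" for m using y_pos[of m] by (simp add: y_Suc)
  have y_mono: "y m \<le> y (Suc m)" for m using y_pos[of m] \<eta>0 by (simp add: y_Suc)
  have powr_Suc: "of_real (y (Suc m)) powr (- s) = exp (- (s * of_real \<eta>)) * of_real (y m) powr (- s)" for m
  proof -
    have "ln (y (Suc m)) = ln (y m) + \<eta>" using ln_y[of m] y_pos[of m] y_pos[of "Suc m"] by (simp add: ln_div)
    thus ?thesis using y_pos[of m] y_pos[of "Suc m"] by (simp add: powr_of_real_exp mult_exp_exp algebra_simps)
  qed
  have grid: "grid_sum N \<eta> K s = (\<Sum>m<K. r m)"
    by (simp only: grid_sum_def r_def y_def)
  have tele: "(\<Sum>m<K. F s (y (Suc m)) - F s (y m)) = F s M - F s N"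
    "(\<Sum>m<K. r (Suc m) - r m) = of_real (R M) * of_real M powr (- s) - of_real (R N) * of_real N powr (- s)"
    using sum_lessThan_telescope[of "\<lambda>m. F s (y m)" K] sum_lessThan_telescope[of r K]
    by (simp_all add: y0 yK r_def)
  have "F s M - F s N - (of_real (R M) * of_real M powr (- s) - of_real (R N) * of_real N powr (- s) +
      (1 - exp (- (s * of_real \<eta>))) * grid_sum N \<eta> K s) =
     (\<Sum>m<K. F s (y (Suc m)) - F s (y m)) - (\<Sum>m<K. r (Suc m) - r m) -
     (\<Sum>m<K. (1 - exp (- (s * of_real \<eta>))) * r m)"
    unfolding tele grid sum_distrib_left[symmetric] by (simp add: algebra_simps)
  also have "\<dots> = (\<Sum>m<K. F s (y (Suc m)) - F s (y m) - of_real (R (y (Suc m)) - R (y m)) * of_real (y (Suc m)) powr (- s))"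
    unfolding sum_subtractf[symmetric] by (intro sum.cong refl) (simp add: r_def powr_Suc algebra_simps)
  finally have eq: "F s M - F s N - (of_real (R M) * of_real M powr (- s) - of_real (R N) * of_real N powr (- s) +
      (1 - exp (- (s * of_real \<eta>))) * grid_sum N \<eta> K s) =
    (\<Sum>m<K. F s (y (Suc m)) - F s (y m) - of_real (R (y (Suc m)) - R (y m)) * of_real (y (Suc m)) powr (- s))" .
  have "cmod (F s M - F s N - (of_real (R M) * of_real M powr (- s) - of_real (R N) * of_real N powr (- s) +
      (1 - exp (- (s * of_real \<eta>))) * grid_sum N \<eta> K s)) \<le> (\<Sum>m<K. cmod s * \<eta> * N powr (- Re s) * ((A (y (Suc m)) - A (y m)) + \<rho> * (y (Suc m) - y m)))"
  unfolding eq
  proof (rule sum_norm_le)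
    fix m
    have "cmod (F s (y (Suc m)) - F s (y m) - of_real (R (y (Suc m)) - R (y m)) * of_real (y (Suc m)) powr (- s))
      \<le> cmod s * \<eta> * y m powr (- Re s) * (A (y (Suc m)) - A (y m) + \<rho> * (y (Suc m) - y m))"
      using F_block[OF y_pos y_mono s] by (simp only: ln_y)
    \<comment> \<open>Replacing \<open>y m\<close> by \<open>N\<close> in the power makes the block
      errors telescope too.\<close>
    also have "\<dots> \<le> cmod s * \<eta> * N powr (- Re s) * (A (y (Suc m)) - A (y m) + \<rho> * (y (Suc m) - y m))"
      using A_mono[OF y_mono[of m]] rho y_mono[of m] N s y_le[of m] \<eta>0
      by (intro mult_right_mono mult_left_mono powr_mono2' add_nonneg_nonneg mult_nonneg_nonneg) auto
    finally show "cmod (F s (y (Suc m)) - F s (y m) - of_real (R (y (Suc m)) - R (y m)) * of_real (y (Suc m)) powr (- s))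
      \<le> cmod s * \<eta> * N powr (- Re s) * ((A (y (Suc m)) - A (y m)) + \<rho> * (y (Suc m) - y m))" .
  qed
  also have "\<dots> = cmod s * \<eta> * N powr (- Re s) * ((\<Sum>m<K. A (y (Suc m)) - A (y m)) + \<rho> * (\<Sum>m<K. y (Suc m) - y m))"
    by (simp only: sum_distrib_left[symmetric] sum.distrib)
  also have "\<dots> = cmod s * \<eta> * N powr (- Re s) * (A M - A N + \<rho> * (M - N))"
    by (simp only: sum_lessThan_telescope[of "\<lambda>m. A (y m)"] sum_lessThan_telescope[of y] y0 yK)
  finally show ?thesis .
qed

lemma remainder_term_bound:
  assumes R: "\<And>x. x \<ge> x0 \<Longrightarrow> \<bar>R x\<bar> \<le> C * x powr \<beta>" and x: "x > 0" "x \<ge> x0"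
  shows "cmod (of_real (R x) * of_real x powr (- s)) \<le> C * x powr (\<beta> - Re s)"
proof -
  have "cmod (of_real (R x) * of_real x powr (- s)) = \<bar>R x\<bar> * x powr (- Re s)"
    using x by (simp add: norm_mult norm_of_real_powr)
  also have "\<dots> \<le> C * x powr \<beta> * x powr (- Re s)"
    using R[OF x(2)] by (intro mult_right_mono) auto
  also have "\<dots> = C * x powr (\<beta> - Re s)" by (simp add: powr_diff powr_minus_divide)
  finally show ?thesis .
qed

text \<open>In \<open>F_grid\<close> the number of grid points tends to infinity while N, M and s
  are fixed, so the discretisation error disappears. The 2 stems from the two boundary terms, the
  other summand from the grid sum.\<close>

lemma F_diff_bound:
  assumes R: "\<And>x. x \<ge> x0 \<Longrightarrow> \<bar>R x\<bar> \<le> C * x powr \<beta>" and C: "C > 0"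
    and N: "0 < N" "x0 \<le> N" "N \<le> M" and s: "Re s > \<beta>" "s \<noteq> 1"
  shows "cmod (F s M - F s N) \<le> C * (2 + cmod s / (Re s - \<beta>)) * N powr (\<beta> - Re s)"
proof -
  define L where "L = ln (M / N)"
  define \<alpha> where "\<alpha> = Re s - \<beta>"
  define P where "P = N powr (- Re s) * (A M - A N + \<rho> * (M - N))"
  have L: "L \<ge> 0" using N by (simp add: L_def)
  have \<alpha>: "\<alpha> > 0" using s by (simp add: \<alpha>_def)
  have term_bound: "cmod (of_real (R x) * of_real x powr (- s)) \<le> C * x powr (- \<alpha>)" if "x \<ge> N" for x
    using remainder_term_bound[where x = x and s = s, OF R] that N by (simp add: \<alpha>_def)
  have bound: "cmod (F s M - F s N) \<le>
      2 * C * N powr (- \<alpha>) + cmod s * C * (L / real K + 1 / \<alpha>) * N powr (- \<alpha>) + cmod s * (L / real K) * P"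
    if K: "K > 0" for K
  proof -
    define \<eta> where "\<eta> = L / real K"
    define u where "u = of_real (R M) * of_real M powr (- s)"
    define v where "v = of_real (R N) * of_real N powr (- s)"
    define w where "w = (1 - exp (- (s * of_real \<eta>))) * grid_sum N \<eta> K s"
    have \<eta>: "\<eta> \<ge> 0" using L by (simp add: \<eta>_def)
    have u: "cmod u \<le> C * N powr (- \<alpha>)"
    proof -
      have "M powr (- \<alpha>) \<le> N powr (- \<alpha>)" using N \<alpha> by (intro powr_mono2') auto
      thus ?thesis using term_bound[of M] N C by (smt (verit) mult_left_mono u_def)
    qed
    have v: "cmod v \<le> C * N powr (- \<alpha>)" using term_bound[of N] by (simp add: v_def)
    have "cmod (grid_sum N \<eta> K s) \<le> (\<Sum>m<K. C * (N * exp (real m * \<eta>)) powr (- \<alpha>))"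
      unfolding grid_sum_def using N \<eta> by (intro sum_norm_le term_bound) simp
    also have "\<dots> = C * (\<Sum>m<K. (N * exp (real m * \<eta>)) powr (- \<alpha>))" by (simp only: sum_distrib_left)
    finally have g: "cmod (grid_sum N \<eta> K s) \<le> C * (\<Sum>m<K. (N * exp (real m * \<eta>)) powr (- \<alpha>))" .
    have e: "cmod (1 - exp (- (s * of_real \<eta>))) \<le> cmod s * \<eta>"
    proof -
      have "cmod (1 - exp (- (s * of_real \<eta>))) \<le> cmod (s * of_real \<eta>)"
        using s beta \<eta> by (intro norm_one_minus_exp_le) simp
      thus ?thesis using \<eta> by (simp add: norm_mult)
    qed
    have "cmod w \<le> (cmod s * \<eta>) * (C * (\<Sum>m<K. (N * exp (real m * \<eta>)) powr (- \<alpha>)))"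
      unfolding w_def norm_mult using e g \<eta> by (intro mult_mono) auto
    also have "\<dots> = cmod s * C * (\<eta> * (\<Sum>m<K. (N * exp (real m * \<eta>)) powr (- \<alpha>)))" by simp
    also have "\<dots> \<le> cmod s * C * ((\<eta> + 1 / \<alpha>) * N powr (- \<alpha>))"
      using geometric_powr_sum_bound[of N \<eta> \<alpha> K] N \<eta> \<alpha> C by (intro mult_left_mono) auto
    finally have w: "cmod w \<le> cmod s * C * (\<eta> + 1 / \<alpha>) * N powr (- \<alpha>)" by (simp only: mult.assoc)
    have "cmod (F s M - F s N - (u - v + w)) \<le> cmod s * \<eta> * N powr (- Re s) * (A M - A N + \<rho> * (M - N))"
      unfolding u_def v_def w_def using N K s beta by (intro F_grid) (auto simp: \<eta>_def L_def)
    also have "\<dots> = cmod s * \<eta> * P" by (simp add: P_def)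
    finally have "cmod (F s M - F s N - (u - v + w)) \<le> cmod s * \<eta> * P" .
    moreover have "cmod (F s M - F s N) \<le> cmod (F s M - F s N - (u - v + w)) + cmod u + cmod v + cmod w"
    proof -
      have "F s M - F s N = (F s M - F s N - (u - v + w)) + (u - v) + w" by simp
      thus ?thesis by (smt (verit) norm_triangle_ineq norm_triangle_ineq4)
    qed
    ultimately show ?thesis using u v w unfolding \<eta>_def by linarith
  qed
  have "((\<lambda>K. 2 * C * N powr (- \<alpha>) + cmod s * C * (L / real K + 1 / \<alpha>) * N powr (- \<alpha>) + cmod s * (L / real K) * P)
      \<longlonglongrightarrow> 2 * C * N powr (- \<alpha>) + cmod s * C * (0 + 1 / \<alpha>) * N powr (- \<alpha>) + cmod s * 0 * P)"
    by (intro tendsto_intros lim_const_over_n)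
  moreover have "eventually (\<lambda>K. cmod (F s M - F s N) \<le>
      2 * C * N powr (- \<alpha>) + cmod s * C * (L / real K + 1 / \<alpha>) * N powr (- \<alpha>) + cmod s * (L / real K) * P) sequentially"
    using eventually_gt_at_top[of 0] by eventually_elim (rule bound)
  ultimately have "cmod (F s M - F s N) \<le> 2 * C * N powr (- \<alpha>) + cmod s * C * (0 + 1 / \<alpha>) * N powr (- \<alpha>) + cmod s * 0 * P"
    by (rule tendsto_lowerbound) simp
  thus ?thesis by (simp add: \<alpha>_def algebra_simps)
qed

text \<open>The frequencies are \<open>ln N + m * \<eta>\<close>, so their differences are integer
  multiples of \<eta> and every off-diagonal integral over the length \<open>2 * pi / \<eta>\<close>
  vanishes.\<close>

lemma grid_sum_mean_square:
  assumes N: "N > 0" and \<eta>: "\<eta> > 0"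
  shows "integral {0..2 * pi / \<eta>} (\<lambda>t. (cmod (grid_sum N \<eta> K (Complex \<sigma> t)))\<^sup>2) =
    2 * pi / \<eta> * (\<Sum>m<K. (R (N * exp (real m * \<eta>)))\<^sup>2 * (N * exp (real m * \<eta>)) powr (- (2 * \<sigma>)))"
proof -
  define y where "y = (\<lambda>m. N * exp (real m * \<eta>))"
  define b where "b = (\<lambda>m. R (y m) * y m powr (- \<sigma>))"
  have y_eq: "N * exp (real m * \<eta>) = y m" for m by (simp add: y_def)
  have y: "y m > 0" for m using N by (simp add: y_def)
  have ln_y: "ln (y m) = ln N + real m * \<eta>" for m using N by (simp add: y_def ln_mult)
  have eq: "grid_sum N \<eta> K (Complex \<sigma> t) = (\<Sum>m<K. of_real (b m) * cis (- (t * ln (y m))))" for t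
    unfolding grid_sum_def y_eq
  proof (rule sum.cong[OF refl])
    fix m
    have "of_real (y m) powr (- Complex \<sigma> t) = of_real (y m powr (- \<sigma>)) * cis (- (t * ln (y m)))"
      using y[of m] by (simp add: powr_of_real_exp exp_eq_polar powr_def mult.commute)
    thus "of_real (R (y m)) * of_real (y m) powr (- Complex \<sigma> t) = of_real (b m) * cis (- (t * ln (y m)))"
      by (simp add: b_def)
  qed
  have inj: "inj_on (\<lambda>m. ln (y m)) {..<K}" using \<eta> by (auto simp: inj_on_def ln_y)
  have per: "cis (- (2 * pi / \<eta> * (ln (y j) - ln (y k)))) = 1" for j k
  proof -
    have "- (2 * pi / \<eta> * (ln (y j) - ln (y k))) = 2 * pi * of_int (int k - int j)"
      using \<eta> by (simp add: ln_y field_simps)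
    thus ?thesis by (simp only: cis_multiple_2pi Ints_of_int)
  qed
  have "integral {0..2 * pi / \<eta>} (\<lambda>t. (cmod (\<Sum>m<K. of_real (b m) * cis (- (t * ln (y m)))))\<^sup>2) =
     2 * pi / \<eta> * (\<Sum>m<K. (cmod (of_real (b m)))\<^sup>2)"
    using \<eta> by (subst integral_norm_exp_sum_sq[OF _ inj], simp, simp, unfold per) simp
  also have "(\<Sum>m<K. (cmod (of_real (b m)))\<^sup>2) = (\<Sum>m<K. (R (y m))\<^sup>2 * y m powr (- (2 * \<sigma>)))"
    by (intro sum.cong refl, simp only: norm_of_real power2_abs)
       (simp add: b_def power_mult_distrib power2_eq_square powr_add[symmetric])
  finally show ?thesis by (simp only: eq y_def)
qed

lemma continuous_on_F_line:
  assumes x: "x > 0" and \<sigma>: "\<sigma> < 1"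
  shows "continuous_on T (\<lambda>t. F (Complex \<sigma> t) x)"
proof -
  have "Complex \<sigma> t \<noteq> 1" for t using \<sigma> by (auto simp: complex_eq_iff)
  hence "\<sigma> + \<i> * of_real t \<noteq> 1" for t by (simp add: Complex_eq)
  thus ?thesis
    unfolding F_def Complex_eq using x n_pos by (simp add: powr_of_real_exp) (intro continuous_intros, auto)
qed

lemma continuous_on_grid_sum_line:
  assumes "N > 0"
  shows "continuous_on T (\<lambda>t. grid_sum N \<eta> K (Complex \<sigma> t))"
proof -
  have "N * exp (real m * \<eta>) > 0" for m using assms by simp
  thus ?thesis
    unfolding grid_sum_def Complex_eq by (simp only: powr_of_real_exp) (intro continuous_intros)
qed

text \<open>The pointwise bound for \<open>F\<close> grows with |s|; orthogonality of the grid sum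
  gains the factor \<open>N powr (\<beta> - 1)\<close> on average. In \<open>2 * C + 1\<close> the
  two boundary terms cost C each and the discretisation error 1. The bound does not involve
  M.\<close>

lemma F_diff_mean_square:
  assumes R: "\<And>x. x \<ge> x0 \<Longrightarrow> \<bar>R x\<bar> \<le> C * x powr \<beta>" and C: "C > 0"
    and N: "1 \<le> N" "x0 \<le> N" "N < M" and T: "T \<ge> 0" and \<sigma>: "\<sigma> = (1 + \<beta>) / 2"
  shows "integral {0..T} (\<lambda>t. (cmod (F (Complex \<sigma> t) M - F (Complex \<sigma> t) N))\<^sup>2) \<le>
    2 * (2 * C + 1)\<^sup>2 * T + 4 * pi * C\<^sup>2 * (1 + T)\<^sup>2 * (1 + 1 / (1 - \<beta>)) * N powr (\<beta> - 1)"
proof -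
  define L where "L = ln (M / N)"
  define P where "P = N powr (- \<sigma>) * (A M - A N + \<rho> * (M - N))"
  have L: "L > 0" using N by (simp add: L_def)
  have P: "P \<ge> 0" using A_mono[of N M] N rho by (simp add: P_def)
  have \<sigma>': "\<beta> < \<sigma>" "0 \<le> \<sigma>" "\<sigma> < 1" using beta by (simp_all add: \<sigma> field_simps)
  \<comment> \<open>This choice makes \<open>\<eta> * (1 + T) * (1 + P) \<le> 1\<close>. Hence
    \<eta> \<le> 1, the interval \<open>{0..T}\<close> fits into one period
    \<open>2 * pi / \<eta>\<close>, and the discretisation error is at most 1.\<close>
  obtain K where "real K > L * (1 + T) * (1 + P)" using reals_Archimedean2 by blast
  moreover have "L * (1 + T) * (1 + P) > 0" using L T P by simp
  ultimately have K: "real K \<ge> L * (1 + T) * (1 + P)" "K > 0" by (auto intro: gr0I)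
  define \<eta> where "\<eta> = L / real K"
  have \<eta>: "\<eta> > 0" using L K by (simp add: \<eta>_def)
  have "\<eta> * ((1 + T) * (1 + P)) \<le> 1" using K by (simp add: \<eta>_def field_simps)
  hence le1: "\<eta> + \<eta> * T + \<eta> * P + \<eta> * T * P \<le> 1" by (simp add: algebra_simps)
  have nonneg: "\<eta> * T \<ge> 0" "\<eta> * P \<ge> 0" "\<eta> * T * P \<ge> 0" using \<eta> T P by simp_all
  have \<eta>1: "\<eta> \<le> 1" and \<eta>T: "\<eta> * T \<le> 1" and \<eta>P: "(1 + T) * \<eta> * P \<le> 1"
    using le1 nonneg \<eta> by (simp_all add: algebra_simps)
  define g where "g = (\<lambda>t. grid_sum N \<eta> K (Complex \<sigma> t))"
  have Rx: "cmod (of_real (R x) * of_real x powr (- Complex \<sigma> t)) \<le> C" if "x \<ge> N" for x t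
  proof -
    have "cmod (of_real (R x) * of_real x powr (- Complex \<sigma> t)) \<le> C * x powr (\<beta> - \<sigma>)"
      using remainder_term_bound[where x = x and s = "Complex \<sigma> t", OF R] that N by simp
    also have "x powr (\<beta> - \<sigma>) \<le> 1 powr (\<beta> - \<sigma>)" using that N \<sigma>' by (intro powr_mono2') auto
    finally show ?thesis using C by simp
  qed
  have pointwise: "(cmod (F (Complex \<sigma> t) M - F (Complex \<sigma> t) N))\<^sup>2 \<le>
      2 * (2 * C + 1)\<^sup>2 + 2 * ((1 + T) * \<eta>)\<^sup>2 * (cmod (g t))\<^sup>2" if t: "t \<in> {0..T}" for t
  proof -
    define s where "s = Complex \<sigma> t"
    define u where "u = of_real (R M) * of_real M powr (- s)"
    define v where "v = of_real (R N) * of_real N powr (- s)"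
    define w where "w = (1 - exp (- (s * of_real \<eta>))) * g t"
    have s: "Re s = \<sigma>" "s \<noteq> 1" using \<sigma>' by (auto simp: s_def complex_eq_iff)
    have cs: "cmod s \<le> 1 + T" using cmod_le[of s] t \<sigma>' by (simp add: s_def)
    have "cmod (F s M - F s N - (u - v + w)) \<le> cmod s * \<eta> * N powr (- Re s) * (A M - A N + \<rho> * (M - N))"
      unfolding u_def v_def w_def g_def s_def[symmetric] using N K s \<sigma>'
      by (intro F_grid) (auto simp: \<eta>_def L_def)
    also have "\<dots> = cmod s * (\<eta> * P)" by (simp add: P_def s)
    also have "\<dots> \<le> (1 + T) * (\<eta> * P)" using cs nonneg by (intro mult_right_mono) auto
    also have "\<dots> \<le> 1" using \<eta>P by (simp add: mult_ac)
    finally have "cmod (F s M - F s N - (u - v + w)) \<le> 1" .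
    moreover have "cmod (F s M - F s N) \<le> cmod (F s M - F s N - (u - v + w)) + cmod u + cmod v + cmod w"
    proof -
      have "F s M - F s N = (F s M - F s N - (u - v + w)) + (u - v) + w" by simp
      thus ?thesis by (smt (verit) norm_triangle_ineq norm_triangle_ineq4)
    qed
    moreover have "cmod u \<le> C" "cmod v \<le> C" unfolding u_def v_def s_def using N by (auto intro: Rx)
    moreover have "cmod w \<le> (1 + T) * \<eta> * cmod (g t)"
    proof -
      have "cmod (1 - exp (- (s * of_real \<eta>))) \<le> cmod (s * of_real \<eta>)"
        using s \<sigma>' \<eta> by (intro norm_one_minus_exp_le) simp
      also have "\<dots> \<le> (1 + T) * \<eta>" using cs \<eta> by (simp add: norm_mult)
      finally show ?thesis unfolding w_def norm_mult by (rule mult_right_mono) simp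
    qed
    ultimately have "cmod (F s M - F s N) \<le> (2 * C + 1) + (1 + T) * \<eta> * cmod (g t)" by linarith
    hence "(cmod (F s M - F s N))\<^sup>2 \<le> ((2 * C + 1) + (1 + T) * \<eta> * cmod (g t))\<^sup>2"
      by (intro power_mono) auto
    also have "\<dots> \<le> 2 * (2 * C + 1)\<^sup>2 + 2 * ((1 + T) * \<eta> * cmod (g t))\<^sup>2"
      using sum_squares_bound[of "2 * C + 1" "(1 + T) * \<eta> * cmod (g t)"] by (simp add: power2_sum)
    finally show ?thesis by (simp add: s_def power_mult_distrib)
  qed
  have cont_g: "continuous_on X (\<lambda>t. (cmod (g t))\<^sup>2)" for X
    unfolding g_def using N by (intro continuous_intros continuous_on_grid_sum_line) auto
  have cont_F: "continuous_on X (\<lambda>t. (cmod (F (Complex \<sigma> t) M - F (Complex \<sigma> t) N))\<^sup>2)" for X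
    using N \<sigma>' by (intro continuous_intros continuous_on_F_line) auto
  have period: "T \<le> 2 * pi / \<eta>"
  proof -
    have "\<eta> * T \<le> 2 * pi" using \<eta>T pi_gt3 by linarith
    thus ?thesis using \<eta> by (simp add: field_simps)
  qed
  have "integral {0..T} (\<lambda>t. (cmod (g t))\<^sup>2) \<le> integral {0..2 * pi / \<eta>} (\<lambda>t. (cmod (g t))\<^sup>2)"
    using period by (intro integral_subset_le integrable_continuous_real cont_g) auto
  also have "\<dots> = 2 * pi / \<eta> * (\<Sum>m<K. (R (N * exp (real m * \<eta>)))\<^sup>2 * (N * exp (real m * \<eta>)) powr (- (2 * \<sigma>)))"
    unfolding g_def using N \<eta> by (intro grid_sum_mean_square) auto
  also have "\<dots> \<le> 2 * pi / \<eta> * (\<Sum>m<K. C\<^sup>2 * (N * exp (real m * \<eta>)) powr (- (1 - \<beta>)))"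
  proof (intro mult_left_mono sum_mono)
    fix m
    define y where "y = N * exp (real m * \<eta>)"
    have y: "y \<ge> N" using N \<eta> by (simp add: y_def)
    have "(R y)\<^sup>2 \<le> (C * y powr \<beta>)\<^sup>2" using R[of y] y N by (intro power2_le_iff_abs_le[THEN iffD2]) auto
    hence "(R y)\<^sup>2 * y powr (- (2 * \<sigma>)) \<le> (C * y powr \<beta>)\<^sup>2 * y powr (- (2 * \<sigma>))" by (intro mult_right_mono) auto
    also have "\<dots> = C\<^sup>2 * (y powr \<beta> * y powr \<beta> * y powr (- (2 * \<sigma>)))"
      by (simp add: power_mult_distrib power2_eq_square)
    also have "y powr \<beta> * y powr \<beta> * y powr (- (2 * \<sigma>)) = y powr (- (1 - \<beta>))"
    proof -
      have "\<beta> + \<beta> + - (2 * \<sigma>) = - (1 - \<beta>)" by (simp add: \<sigma> field_simps)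
      thus ?thesis by (simp only: powr_add[symmetric])
    qed
    finally show "(R y)\<^sup>2 * y powr (- (2 * \<sigma>)) \<le> C\<^sup>2 * y powr (- (1 - \<beta>))" .
  qed (use \<eta> in auto)
  \<comment> \<open>One factor \<open>1 / \<eta>\<close> is the period and the other normalises the
    Riemann sum; together they cancel against \<open>((1 + T) * \<eta>)^2\<close> from the pointwise
    bound.\<close>
  also have "2 * pi / \<eta> * (\<Sum>m<K. C\<^sup>2 * (N * exp (real m * \<eta>)) powr (- (1 - \<beta>))) =
      2 * pi * C\<^sup>2 / \<eta>\<^sup>2 * (\<eta> * (\<Sum>m<K. (N * exp (real m * \<eta>)) powr (- (1 - \<beta>))))"
    unfolding sum_distrib_left[symmetric] using \<eta> by (simp add: power2_eq_square)
  also have "\<dots> \<le> 2 * pi * C\<^sup>2 / \<eta>\<^sup>2 * ((\<eta> + 1 / (1 - \<beta>)) * N powr (- (1 - \<beta>)))"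
    using N \<eta> beta by (intro mult_left_mono geometric_powr_sum_bound) auto
  also have "\<dots> \<le> 2 * pi * C\<^sup>2 / \<eta>\<^sup>2 * ((1 + 1 / (1 - \<beta>)) * N powr (- (1 - \<beta>)))"
    using \<eta>1 by (intro mult_left_mono mult_right_mono) auto
  finally have g_bound: "integral {0..T} (\<lambda>t. (cmod (g t))\<^sup>2) \<le>
      2 * pi * C\<^sup>2 / \<eta>\<^sup>2 * ((1 + 1 / (1 - \<beta>)) * N powr (- (1 - \<beta>)))" .
  have "integral {0..T} (\<lambda>t. (cmod (F (Complex \<sigma> t) M - F (Complex \<sigma> t) N))\<^sup>2) \<le>
      integral {0..T} (\<lambda>t. 2 * (2 * C + 1)\<^sup>2 + 2 * ((1 + T) * \<eta>)\<^sup>2 * (cmod (g t))\<^sup>2)"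
    by (intro integral_le integrable_continuous_real continuous_intros cont_F cont_g pointwise)
  also have "\<dots> = 2 * (2 * C + 1)\<^sup>2 * T + 2 * ((1 + T) * \<eta>)\<^sup>2 * integral {0..T} (\<lambda>t. (cmod (g t))\<^sup>2)"
    using T by (subst Henstock_Kurzweil_Integration.integral_add)
      (auto intro!: integrable_continuous_real continuous_intros cont_g)
  also have "\<dots> \<le> 2 * (2 * C + 1)\<^sup>2 * T + 2 * ((1 + T) * \<eta>)\<^sup>2 *
       (2 * pi * C\<^sup>2 / \<eta>\<^sup>2 * ((1 + 1 / (1 - \<beta>)) * N powr (- (1 - \<beta>))))"
    using g_bound by (intro add_left_mono mult_left_mono) auto
  also have "\<dots> = 2 * (2 * C + 1)\<^sup>2 * T + 4 * pi * C\<^sup>2 * (1 + T)\<^sup>2 * (1 + 1 / (1 - \<beta>)) * N powr (\<beta> - 1)"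
    using \<eta> by (simp add: power_mult_distrib)
  finally show ?thesis .
qed

subsection \<open>The continuation\<close>

text \<open>Taking x along the sequence \<open>n\<close> gives a sequence of holomorphic functions
  for the uniform limit theorem, and the sum in \<open>F s (n k)\<close> runs exactly over j \<le>
  k.\<close>

definition F_lim :: "complex \<Rightarrow> complex" where "F_lim s = lim (\<lambda>k. F s (n k))"

lemma F_n_tendsto:
  assumes s: "Re s > \<beta>" "s \<noteq> 1"
  shows "(\<lambda>k. F s (n k)) \<longlonglongrightarrow> F_lim s"
proof -
  obtain C x0 where C: "C > 0" and x0: "x0 \<ge> 1" and R: "\<And>x. x \<ge> x0 \<Longrightarrow> \<bar>R x\<bar> \<le> C * x powr \<beta>"
    using remainder_bound by blast
  define B where "B = C * (2 + cmod s / (Re s - \<beta>))"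
  have B: "B > 0" using C s by (simp add: B_def add_pos_nonneg)
  have lim: "(\<lambda>k. B * n k powr (\<beta> - Re s)) \<longlonglongrightarrow> B * 0"
    using s by (intro tendsto_mult tendsto_const tendsto_neg_powr n_at_top) auto
  have "Cauchy (\<lambda>k. F s (n k))"
  proof (rule CauchyI')
    fix e :: real assume e: "e > 0"
    have "eventually (\<lambda>k. B * n k powr (\<beta> - Re s) < e \<and> n k \<ge> x0) sequentially"
      using order_tendstoD(2)[OF lim, of e] e n_at_top by (auto intro!: eventually_conj simp: filterlim_at_top)
    then obtain k0 where k0: "\<And>k. k \<ge> k0 \<Longrightarrow> B * n k powr (\<beta> - Re s) < e \<and> n k \<ge> x0"
      by (auto simp: eventually_sequentially)
    have "dist (F s (n k)) (F s (n m)) < e" if km: "k \<ge> k0" "m > k" for k m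
    proof -
      have "cmod (F s (n m) - F s (n k)) \<le> B * n k powr (\<beta> - Re s)"
        unfolding B_def using k0[OF km(1)] km n_pos[of k]
        by (intro F_diff_bound[OF R C _ _ _ s]) (auto simp: less_imp_le)
      thus ?thesis using k0[OF km(1)] by (simp add: dist_norm norm_minus_commute)
    qed
    thus "\<exists>M. \<forall>m\<ge>M. \<forall>k>m. dist (F s (n m)) (F s (n k)) < e" by blast
  qed
  thus ?thesis unfolding F_lim_def by (simp add: Cauchy_convergent_iff convergent_LIMSEQ_iff)
qed

lemma F_lim_diff_bound:
  assumes R: "\<And>x. x \<ge> x0 \<Longrightarrow> \<bar>R x\<bar> \<le> C * x powr \<beta>" and C: "C > 0"
    and N: "0 < N" "x0 \<le> N" and s: "Re s > \<beta>" "s \<noteq> 1"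
  shows "cmod (F_lim s - F s N) \<le> C * (2 + cmod s / (Re s - \<beta>)) * N powr (\<beta> - Re s)"
proof (rule tendsto_upperbound)
  show "(\<lambda>k. cmod (F s (n k) - F s N)) \<longlonglongrightarrow> cmod (F_lim s - F s N)"
    by (intro tendsto_intros F_n_tendsto s)
  have "eventually (\<lambda>k. n k \<ge> N) sequentially" using n_at_top by (simp add: filterlim_at_top)
  thus "eventually (\<lambda>k. cmod (F s (n k) - F s N) \<le> C * (2 + cmod s / (Re s - \<beta>)) * N powr (\<beta> - Re s)) sequentially"
    by eventually_elim (rule F_diff_bound[OF R C N _ s])
qed simp

lemma open_domain: "open ({s. Re s > \<beta>} - {1})"
  by (intro open_Diff open_halfspace_Re_gt closed_singleton)

lemma F_holomorphic: "(\<lambda>s. F s x) holomorphic_on ({s. Re s > \<beta>} - {1})"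
  unfolding F_def by (intro holomorphic_intros) auto

lemma F_lim_holomorphic: "F_lim holomorphic_on ({s. Re s > \<beta>} - {1})"
proof (rule holomorphic_uniform_sequence[OF open_domain F_holomorphic])
  fix z assume z: "z \<in> {s. Re s > \<beta>} - {1}"
  obtain C x0 where C: "C > 0" and x0: "x0 \<ge> 1" and R: "\<And>x. x \<ge> x0 \<Longrightarrow> \<bar>R x\<bar> \<le> C * x powr \<beta>"
    using remainder_bound by blast
  obtain d1 where d1: "d1 > 0" "cball z d1 \<subseteq> {s. Re s > \<beta>} - {1}"
    using open_domain z open_contains_cball by blast
  \<comment> \<open>Half the distance of z from the boundary line: on the disc
    \<open>Re s - \<beta> \<ge> \<epsilon>\<close>, so \<open>F_lim_diff_bound\<close> gives the
    uniform rate \<open>n k powr (- \<epsilon>)\<close>.\<close>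
  define \<epsilon> where "\<epsilon> = (Re z - \<beta>) / 2"
  have \<epsilon>: "\<epsilon> > 0" using z by (simp add: \<epsilon>_def)
  define d where "d = min d1 \<epsilon>"
  have d: "d > 0" "cball z d \<subseteq> {s. Re s > \<beta>} - {1}" using d1 \<epsilon> by (auto simp: d_def)
  define B where "B = C * (2 + (cmod z + d) / \<epsilon>)"
  have bound: "dist (F s (n k)) (F_lim s) \<le> B * n k powr (- \<epsilon>)" if s: "s \<in> cball z d" and k: "n k \<ge> x0" for s k
  proof -
    have s': "Re s > \<beta>" "s \<noteq> 1" using s d by auto
    have "cmod (z - s) \<le> \<epsilon>" using s by (simp add: dist_norm d_def)
    hence "Re z - Re s \<le> \<epsilon>" using complex_Re_le_cmod[of "z - s"] by simp
    hence re: "Re s - \<beta> \<ge> \<epsilon>" unfolding \<epsilon>_def by (simp add: field_simps)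
    have cs: "cmod s \<le> cmod z + d" using s norm_triangle_sub[of s z] by (simp add: dist_norm norm_minus_commute)
    have "cmod (F_lim s - F s (n k)) \<le> C * (2 + cmod s / (Re s - \<beta>)) * n k powr (\<beta> - Re s)"
      using k n_pos by (intro F_lim_diff_bound[OF R C _ _ s'])
    also have "\<dots> \<le> B * n k powr (- \<epsilon>)"
      unfolding B_def using C cs re \<epsilon> d k x0
      by (intro mult_mono mult_left_mono add_left_mono frac_le powr_mono add_nonneg_nonneg mult_nonneg_nonneg) auto
    finally show ?thesis by (simp add: dist_norm norm_minus_commute)
  qed
  have lim: "(\<lambda>k. B * n k powr (- \<epsilon>)) \<longlonglongrightarrow> B * 0"
    using \<epsilon> by (intro tendsto_mult tendsto_const tendsto_neg_powr n_at_top) auto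
  have "uniform_limit (cball z d) (\<lambda>k s. F s (n k)) F_lim sequentially"
  proof (rule uniform_limitI)
    fix e :: real assume "e > 0"
    hence "eventually (\<lambda>k. B * n k powr (- \<epsilon>) < e \<and> n k \<ge> x0) sequentially"
      using order_tendstoD(2)[OF lim, of e] n_at_top by (auto intro!: eventually_conj simp: filterlim_at_top)
    thus "eventually (\<lambda>k. \<forall>s\<in>cball z d. dist (F s (n k)) (F_lim s) < e) sequentially"
      by eventually_elim (use bound in \<open>blast intro: le_less_trans\<close>)
  qed
  thus "\<exists>d>0. cball z d \<subseteq> {s. Re s > \<beta>} - {1} \<and> uniform_limit (cball z d) (\<lambda>k s. F s (n k)) F_lim sequentially"
    using d by blast
qed

text \<open>For Re s > 1 the correction term in \<open>F s (n k)\<close> tends to 0, leaving the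
  ordinary partial sums.\<close>

lemma F_lim_sums:
  assumes s: "Re s > 1"
  shows "(\<lambda>j. of_real (a j) * of_real (n j) powr (- s)) sums F_lim s"
proof -
  have "(\<lambda>k. n k powr (1 - Re s)) \<longlonglongrightarrow> 0"
    using s by (intro tendsto_neg_powr n_at_top) auto
  hence "(\<lambda>k. of_real (n k) powr (1 - s)) \<longlonglongrightarrow> 0"
    by (subst tendsto_norm_zero_iff[symmetric]) (simp add: norm_of_real_powr n_pos)
  hence "(\<lambda>k. F s (n k) - of_real \<rho> * of_real (n k) powr (1 - s) / (s - 1)) \<longlonglongrightarrow> F_lim s - of_real \<rho> * 0 / (s - 1)"
    using s beta by (intro tendsto_intros F_n_tendsto) auto
  moreover have "F s (n k) - of_real \<rho> * of_real (n k) powr (1 - s) / (s - 1) =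
     (\<Sum>j\<le>k. of_real (a j) * of_real (n j) powr (- s))" for k
    by (simp add: F_def atMost_def)
  ultimately show ?thesis by (simp add: sums_def_le)
qed

text \<open>\<open>F_lim\<close> witnesses that a continuation exists, so the choice operator
  returns one. The two agree on Re s > 1, hence on the whole domain by the identity theorem: a
  half-plane without one point is connected.\<close>

lemma dirichlet_continuation_eq:
  assumes s: "Re s > \<beta>" "s \<noteq> 1"
  shows "dirichlet_continuation a n \<beta> s = F_lim s"
proof -
  let ?U = "{s. Re s > \<beta>} - {1}"
  have "is_dirichlet_continuation a n \<beta> F_lim"
    unfolding is_dirichlet_continuation_def using F_lim_holomorphic F_lim_sums by blast
  hence is_cont: "is_dirichlet_continuation a n \<beta> (dirichlet_continuation a n \<beta>)"
    unfolding dirichlet_continuation_def by (rule someI[of "is_dirichlet_continuation a n \<beta>"])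
  show ?thesis
  proof (rule analytic_continuation_open[where s = "{s. Re s > 1}" and s' = ?U
        and f = "dirichlet_continuation a n \<beta>" and g = F_lim])
    show "connected ?U"
      by (intro connected_open_delete open_halfspace_Re_gt convex_connected convex_halfspace_Re_gt) simp
    show "dirichlet_continuation a n \<beta> z = F_lim z" if "z \<in> {s. Re s > 1}" for z
      using is_cont F_lim_sums[of z] that sums_unique2 unfolding is_dirichlet_continuation_def by blast
    have "2 \<in> {s. Re s > 1}" by simp
    thus "{s. Re s > 1} \<noteq> {}" by blast
  qed (use is_cont F_lim_holomorphic open_domain beta s in
      \<open>auto simp: is_dirichlet_continuation_def open_halfspace_Re_gt\<close>)
qed

end

subsection \<open>The mean square on the critical line\<close>

text \<open>Comparison with \<open>2 / (b + t)^2\<close>, which has an elementary antiderivative. It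
  serves for the mean square of the correction term in \<open>F\<close>.\<close>

lemma integral_inverse_square_sum_le:
  fixes b T :: real
  assumes b: "b > 0" and T: "T \<ge> 0"
  shows "integral {0..T} (\<lambda>t. 1 / (b\<^sup>2 + t\<^sup>2)) \<le> 2 / b"
proof -
  have int: "((\<lambda>t. 2 / (b + t)\<^sup>2) has_integral (- 2 / (b + T)) - (- 2 / (b + 0))) {0..T}"
  proof (rule fundamental_theorem_of_calculus[OF T])
    fix t assume "t \<in> {0..T}"
    hence "b + t \<noteq> 0" using b by auto
    hence "((\<lambda>t. - 2 / (b + t)) has_field_derivative 2 / (b + t)\<^sup>2) (at t within {0..T})"
      by (auto intro!: derivative_eq_intros simp: power2_eq_square)
    thus "((\<lambda>t. - 2 / (b + t)) has_vector_derivative 2 / (b + t)\<^sup>2) (at t within {0..T})"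
      by (simp add: has_real_derivative_iff_has_vector_derivative)
  qed
  have den: "b\<^sup>2 + t\<^sup>2 > 0" for t using b by (intro add_pos_nonneg) auto
  have "integral {0..T} (\<lambda>t. 1 / (b\<^sup>2 + t\<^sup>2)) \<le> integral {0..T} (\<lambda>t. 2 / (b + t)\<^sup>2)"
  proof (rule integral_le)
    show "(\<lambda>t. 1 / (b\<^sup>2 + t\<^sup>2)) integrable_on {0..T}"
      using den by (intro integrable_continuous_real continuous_intros) (metis less_irrefl)
    show "(\<lambda>t. 2 / (b + t)\<^sup>2) integrable_on {0..T}" using int by (rule has_integral_integrable)
    fix t assume "t \<in> {0..T}"
    hence t: "b + t > 0" using b by auto
    have "(b + t)\<^sup>2 \<le> 2 * (b\<^sup>2 + t\<^sup>2)"
      using sum_squares_bound[of b t] by (simp add: power2_sum)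
    thus "1 / (b\<^sup>2 + t\<^sup>2) \<le> 2 / (b + t)\<^sup>2"
      using t den[of t] by (simp add: field_simps)
  qed
  also have "\<dots> = 2 / b - 2 / (b + T)" using int by (simp add: integral_unique)
  also have "\<dots> \<le> 2 / b" using b T by simp
  finally show ?thesis .
qed

text \<open>Cauchy-Schwarz in weighted form: the cross term is split by the arithmetic-geometric
  mean inequality with a free parameter \<theta>, so that pointwise integration suffices and
  \<theta> can be optimised afterwards.\<close>

lemma norm_sq_diff_le:
  fixes z w :: complex and \<theta> :: real
  assumes \<theta>: "\<theta> > 0"
  shows "\<bar>(cmod z)\<^sup>2 - (cmod w)\<^sup>2\<bar> \<le> \<theta> * (cmod w)\<^sup>2 + (1 / \<theta> + 1) * (cmod (z - w))\<^sup>2"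
proof -
  define p q where "p = cmod w" and "q = cmod (z - w)"
  have "\<bar>cmod z - p\<bar> \<le> q" unfolding p_def q_def by (rule norm_triangle_ineq3)
  hence "\<bar>(cmod z)\<^sup>2 - p\<^sup>2\<bar> \<le> q * (2 * p + q)"
  proof -
    assume le: "\<bar>cmod z - p\<bar> \<le> q"
    have "(cmod z)\<^sup>2 - p\<^sup>2 = (cmod z - p) * (cmod z + p)" by (simp add: power2_eq_square algebra_simps)
    hence "\<bar>(cmod z)\<^sup>2 - p\<^sup>2\<bar> = \<bar>cmod z - p\<bar> * (cmod z + p)" by (simp add: abs_mult p_def)
    also have "\<dots> \<le> q * (2 * p + q)" using le by (intro mult_mono) (auto simp: p_def)
    finally show ?thesis .
  qed
  also have "\<dots> = 2 * (p * q) + q\<^sup>2" by (simp add: power2_eq_square algebra_simps)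
  also have "2 * (p * q) \<le> \<theta> * p\<^sup>2 + q\<^sup>2 / \<theta>"
  proof -
    have "0 \<le> (\<theta> * p - q)\<^sup>2 / \<theta>" using \<theta> by simp
    also have "\<dots> = \<theta> * p\<^sup>2 + q\<^sup>2 / \<theta> - 2 * (p * q)"
      using \<theta> by (simp add: power2_eq_square field_simps)
    finally show ?thesis by simp
  qed
  finally show ?thesis by (simp add: p_def q_def algebra_simps)
qed

section \<open>Approximation by a Dirichlet polynomial and the final comparison\<close>

context dirichlet_series
begin

lemma continuous_on_f0_line:
  assumes "\<beta> < \<sigma>" "\<sigma> < 1"
  shows "continuous_on X (\<lambda>t. F_lim (Complex \<sigma> t))"
proof -
  have "continuous_on X (F_lim \<circ> Complex \<sigma>)"
  proof (rule continuous_on_compose)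
    show "continuous_on X (Complex \<sigma>)" unfolding Complex_eq by (intro continuous_intros)
    have "Complex \<sigma> ` X \<subseteq> {s. Re s > \<beta>} - {1}" using assms by (auto simp: complex_eq_iff)
    thus "continuous_on (Complex \<sigma> ` X) F_lim"
      by (rule continuous_on_subset[OF holomorphic_on_imp_continuous_on[OF F_lim_holomorphic]])
  qed
  thus ?thesis by (simp add: o_def)
qed

definition S :: "real \<Rightarrow> real \<Rightarrow> real \<Rightarrow> complex" where
  "S \<sigma> x t = (\<Sum>j | n j \<le> x. of_real (a j * n j powr (- \<sigma>)) * cis (- (t * ln (n j))))"

lemma F_eq_S: "F (Complex \<sigma> t) x = S \<sigma> x t + of_real \<rho> * of_real x powr (1 - Complex \<sigma> t) / (Complex \<sigma> t - 1)"
proof -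
  have "of_real (n j) powr (- Complex \<sigma> t) = of_real (n j powr (- \<sigma>)) * cis (- (t * ln (n j)))" for j
    using n_pos[of j] by (simp add: powr_of_real_exp exp_eq_polar powr_def mult.commute)
  thus ?thesis by (simp add: F_def S_def mult.assoc)
qed

text \<open>With \<open>N = T powr (1 / (1 - \<beta>))\<close> the difference splits into three
  parts: the limit minus \<open>F\<close> at a huge cutoff M, the increment of \<open>F\<close> from
  N to M, and the correction term at N. Each has mean square O(T) over
  \<open>{0..T}\<close>.\<close>

lemma F_lim_minus_S_mean_square:
  assumes \<sigma>: "\<sigma> = (1 + \<beta>) / 2"
  shows "\<exists>E\<ge>0. \<exists>T0\<ge>1. \<forall>T\<ge>T0.
    integral {0..T} (\<lambda>t. (cmod (F_lim (Complex \<sigma> t) - S \<sigma> (T powr (1 / (1 - \<beta>))) t))\<^sup>2) \<le> E * T"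
proof -
  have \<sigma>': "\<beta> < \<sigma>" "0 \<le> \<sigma>" "\<sigma> < 1" using beta by (simp_all add: \<sigma> field_simps)
  obtain C x0 where C: "C > 0" and x0: "x0 \<ge> 1" and R: "\<And>x. x \<ge> x0 \<Longrightarrow> \<bar>R x\<bar> \<le> C * x powr \<beta>"
    using remainder_bound by blast
  define b where "b = 1 - \<sigma>"
  have b: "b > 0" using \<sigma>' by (simp add: b_def)
  define E where "E = 3 * (1 + (2 * (2 * C + 1)\<^sup>2 + 16 * pi * C\<^sup>2 * (1 + 1 / (1 - \<beta>))) + 2 * \<rho>\<^sup>2 / b)"
  have "integral {0..T} (\<lambda>t. (cmod (F_lim (Complex \<sigma> t) - S \<sigma> (T powr (1 / (1 - \<beta>))) t))\<^sup>2) \<le> E * T"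
    if T: "T \<ge> x0" for T
  proof -
    define N where "N = T powr (1 / (1 - \<beta>))"
    have T1: "T \<ge> 1" using T x0 by simp
    have "T powr 1 \<le> N" unfolding N_def using T1 beta by (intro powr_mono) (auto simp: field_simps)
    hence N: "N \<ge> T" using T1 by simp
    have N_pow: "N powr (1 - \<beta>) = T" using T1 beta by (simp add: N_def powr_powr)
    hence N_pow': "N powr (\<beta> - 1) = 1 / T" using powr_minus_divide[of N "1 - \<beta>"] by simp
    \<comment> \<open>\<open>B\<close> is the constant of \<open>F_lim_diff_bound\<close>, made
      uniform over the segment. M may depend on \<open>T\<close>, because the bound for the
      increment from N to M does not involve M.\<close>
    define B where "B = C * (2 + (1 + T) / (\<sigma> - \<beta>))"
    have "((\<lambda>M. B * M powr (\<beta> - \<sigma>)) \<longlongrightarrow> B * 0) at_top"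
      using \<sigma>' by (intro tendsto_mult tendsto_const tendsto_neg_powr filterlim_ident) auto
    hence "eventually (\<lambda>M. B * M powr (\<beta> - \<sigma>) < 1 \<and> M > N) at_top"
      using order_tendstoD(2)[of _ "B * 0" at_top 1] by (intro eventually_conj eventually_gt_at_top) auto
    then obtain M where M: "B * M powr (\<beta> - \<sigma>) < 1" "M > N"
      using eventually_happens[of _ "at_top :: real filter"] by auto
    define u where "u = (\<lambda>t. F (Complex \<sigma> t) M - F (Complex \<sigma> t) N)"
    define g where "g = (\<lambda>t. of_real \<rho> * of_real N powr (1 - Complex \<sigma> t) / (Complex \<sigma> t - 1))"
    have F_lim_F: "cmod (F_lim (Complex \<sigma> t) - F (Complex \<sigma> t) M) \<le> 1" if t: "t \<in> {0..T}" for t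
    proof -
      have cs: "cmod (Complex \<sigma> t) \<le> 1 + T" using cmod_le[of "Complex \<sigma> t"] t \<sigma>' by simp
      have "cmod (F_lim (Complex \<sigma> t) - F (Complex \<sigma> t) M) \<le>
          C * (2 + cmod (Complex \<sigma> t) / (Re (Complex \<sigma> t) - \<beta>)) * M powr (\<beta> - Re (Complex \<sigma> t))"
        using M N T T1 \<sigma>' by (intro F_lim_diff_bound[OF R C]) (auto simp: complex_eq_iff)
      also have "\<dots> \<le> B * M powr (\<beta> - \<sigma>)"
        unfolding B_def using cs C \<sigma>' by (auto intro!: mult_right_mono mult_left_mono add_left_mono divide_right_mono)
      finally show ?thesis using M by simp
    qed
    \<comment> \<open>The cutoff is balanced here:
      \<open>N powr (2 * (1 - \<sigma>)) = N powr (1 - \<beta>) = T\<close>.\<close>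
    have g_norm: "(cmod (g t))\<^sup>2 = \<rho>\<^sup>2 * T * (1 / (b\<^sup>2 + t\<^sup>2))" for t
    proof -
      have "N > 0" using N T1 by linarith
      hence "cmod (of_real N powr (1 - Complex \<sigma> t)) = N powr (1 - \<sigma>)" by (simp add: norm_of_real_powr)
      moreover have "(N powr (1 - \<sigma>))\<^sup>2 = T"
      proof -
        have eq: "(1 - \<sigma>) + (1 - \<sigma>) = 1 - \<beta>" by (simp add: \<sigma> field_simps)
        show ?thesis by (simp only: power2_eq_square powr_add[symmetric] eq N_pow)
      qed
      moreover have "(cmod (Complex \<sigma> t - 1))\<^sup>2 = b\<^sup>2 + t\<^sup>2"
        by (simp add: cmod_power2 b_def power2_commute)
      ultimately show ?thesis by (simp add: g_def norm_mult norm_divide power_mult_distrib power_divide)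
    qed
    have pointwise: "(cmod (F_lim (Complex \<sigma> t) - S \<sigma> N t))\<^sup>2 \<le>
        3 * (1 + (cmod (u t))\<^sup>2 + \<rho>\<^sup>2 * T * (1 / (b\<^sup>2 + t\<^sup>2)))" if t: "t \<in> {0..T}" for t
    proof -
      define w where "w = F_lim (Complex \<sigma> t) - F (Complex \<sigma> t) M"
      have "F_lim (Complex \<sigma> t) - S \<sigma> N t = w + u t + g t"
        by (simp add: w_def u_def g_def F_eq_S[of \<sigma> t N])
      hence "cmod (F_lim (Complex \<sigma> t) - S \<sigma> N t) \<le> cmod w + cmod (u t) + cmod (g t)"
        by (metis add_right_mono norm_triangle_ineq order_trans)
      hence "(cmod (F_lim (Complex \<sigma> t) - S \<sigma> N t))\<^sup>2 \<le> (cmod w + cmod (u t) + cmod (g t))\<^sup>2"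
        by (intro power_mono) auto
      also have "\<dots> \<le> 3 * ((cmod w)\<^sup>2 + (cmod (u t))\<^sup>2 + (cmod (g t))\<^sup>2)"
        using sum_squares_bound[of "cmod w" "cmod (u t)"] sum_squares_bound[of "cmod w" "cmod (g t)"]
          sum_squares_bound[of "cmod (u t)" "cmod (g t)"]
        by (simp add: power2_eq_square algebra_simps)
      also have "(cmod w)\<^sup>2 \<le> 1" using F_lim_F[OF t] by (simp add: w_def power_le_one)
      finally show ?thesis by (simp add: g_norm)
    qed
    have cont_u: "continuous_on X (\<lambda>t. (cmod (u t))\<^sup>2)" for X
      unfolding u_def using M N T1 \<sigma>' by (intro continuous_intros continuous_on_F_line) auto
    have cont_V: "continuous_on X (\<lambda>t. (cmod (F_lim (Complex \<sigma> t) - S \<sigma> N t))\<^sup>2)" for X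
      unfolding S_def using \<sigma>' by (intro continuous_intros continuous_on_f0_line) auto
    have den: "b\<^sup>2 + t\<^sup>2 \<noteq> 0" for t using b by (simp add: sum_power2_eq_zero_iff)
    have int_u: "(\<lambda>t. (cmod (u t))\<^sup>2) integrable_on {0..T}"
      by (intro integrable_continuous_real cont_u)
    have int_q: "(\<lambda>t. 1 / (b\<^sup>2 + t\<^sup>2)) integrable_on {0..T}"
      using den by (intro integrable_continuous_real continuous_intros) auto
    have "((\<lambda>t. 3 * (1 + (cmod (u t))\<^sup>2 + \<rho>\<^sup>2 * T * (1 / (b\<^sup>2 + t\<^sup>2)))) has_integral
        3 * (T + integral {0..T} (\<lambda>t. (cmod (u t))\<^sup>2) + \<rho>\<^sup>2 * T * integral {0..T} (\<lambda>t. 1 / (b\<^sup>2 + t\<^sup>2)))) {0..T}"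
      using has_integral_const_real[of "1::real" 0 T] T1
      by (intro has_integral_mult_right has_integral_add integrable_integral int_u int_q) simp
    hence "integral {0..T} (\<lambda>t. (cmod (F_lim (Complex \<sigma> t) - S \<sigma> N t))\<^sup>2) \<le>
        3 * (T + integral {0..T} (\<lambda>t. (cmod (u t))\<^sup>2) + \<rho>\<^sup>2 * T * integral {0..T} (\<lambda>t. 1 / (b\<^sup>2 + t\<^sup>2)))"
      using pointwise integrable_integral[OF integrable_continuous_real[OF cont_V]]
      by (rule has_integral_le[rotated])
    also have "\<dots> \<le> 3 * (T + (2 * (2 * C + 1)\<^sup>2 * T + 16 * pi * C\<^sup>2 * (1 + 1 / (1 - \<beta>)) * T) + \<rho>\<^sup>2 * T * (2 / b))"
    proof -
      have "integral {0..T} (\<lambda>t. (cmod (u t))\<^sup>2) \<le>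
          2 * (2 * C + 1)\<^sup>2 * T + 4 * pi * C\<^sup>2 * (1 + T)\<^sup>2 * (1 + 1 / (1 - \<beta>)) * N powr (\<beta> - 1)"
        unfolding u_def using N T T1 M by (intro F_diff_mean_square[OF R C _ _ _ _ \<sigma>]) auto
      \<comment> \<open>Since \<open>1 + T \<le> 2 * T\<close> and
        \<open>N powr (\<beta> - 1) = 1 / T\<close>, the quadratic growth in T drops to linear
        growth.\<close>
      also have "\<dots> \<le> 2 * (2 * C + 1)\<^sup>2 * T + 4 * pi * C\<^sup>2 * (2 * T)\<^sup>2 * (1 + 1 / (1 - \<beta>)) * N powr (\<beta> - 1)"
        using T1 beta by (intro add_left_mono mult_right_mono mult_left_mono power_mono) auto
      also have "\<dots> = 2 * (2 * C + 1)\<^sup>2 * T + 16 * pi * C\<^sup>2 * (1 + 1 / (1 - \<beta>)) * T"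
        using T1 by (simp add: N_pow' power2_eq_square)
      finally have "integral {0..T} (\<lambda>t. (cmod (u t))\<^sup>2) \<le> \<dots>" .
      thus ?thesis using integral_inverse_square_sum_le[OF b, of T] T1
        by (intro mult_left_mono add_mono order.refl) auto
    qed
    also have "\<dots> = E * T" by (simp add: E_def algebra_simps)
    finally show ?thesis by (simp add: N_def)
  qed
  moreover have "E \<ge> 0" unfolding E_def using b beta
    by (intro mult_nonneg_nonneg add_nonneg_nonneg divide_nonneg_nonneg) auto
  ultimately show ?thesis using x0 by blast
qed

text \<open>Write D for the diagonal sum. The mean square of \<open>S\<close> over
  \<open>{0..T}\<close> is T D + O(T) and that of the approximation error is O(T), so the cross term
  is of order T sqrt D, apart from terms absorbed by a positive lower bound for D.\<close>

lemma F_lim_mean_square: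
  assumes \<sigma>: "\<sigma> = (1 + \<beta>) / 2"
  shows "(\<lambda>T. 1 / T * integral {0..T} (\<lambda>t. (cmod (F_lim (Complex \<sigma> t)))\<^sup>2) - diagonal_sum a n \<beta> T)
    \<in> O[at_top](\<lambda>T. sqrt (diagonal_sum a n \<beta> T))"
proof -
  have \<sigma>': "\<beta> < \<sigma>" "1 / 2 \<le> \<sigma>" "\<sigma> < 1" using beta by (simp_all add: \<sigma> field_simps)
  obtain E T0 where E: "E \<ge> 0" and T0: "T0 \<ge> 1"
    and V_bound: "\<And>T. T \<ge> T0 \<Longrightarrow>
      integral {0..T} (\<lambda>t. (cmod (F_lim (Complex \<sigma> t) - S \<sigma> (T powr (1 / (1 - \<beta>))) t))\<^sup>2) \<le> E * T"
    using F_lim_minus_S_mean_square[OF \<sigma>] by blast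
  obtain C where C: "C \<ge> 0" and S_bound: "\<And>x T. x > 0 \<Longrightarrow> T \<ge> 0 \<Longrightarrow>
    \<bar>integral {0..T} (\<lambda>t. (cmod (S \<sigma> x t))\<^sup>2) - T * (\<Sum>j | n j \<le> x. (a j)\<^sup>2 * n j powr (- (2 * \<sigma>)))\<bar>
      \<le> C * x powr (2 - 2 * \<sigma>)"
    unfolding S_def using mean_square_dirichlet_polynomial[OF \<sigma>'(2,3)] by blast
  \<comment> \<open>The first term of the diagonal sum is present once \<open>T \<ge> n 0\<close>,
    so \<open>q\<close> bounds sqrt D below and lets constants be absorbed into multiples of sqrt
    D.\<close>
  define q where "q = sqrt ((a 0)\<^sup>2 / n 0 powr (1 + \<beta>))"
  have q: "q > 0" using a_pos[of 0] n_pos[of 0] by (simp add: q_def)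
  \<comment> \<open>The summands absorb, in order, \<open>C\<close>, \<open>r\<close>,
    \<open>C / r\<close>, \<open>E * r\<close> and \<open>E\<close> into multiples of
    \<open>r\<close>, using \<open>r \<ge> q\<close>.\<close>
  define Z where "Z = C / q + 1 + C / q\<^sup>2 + E + E / q"
  show ?thesis
  proof (rule landau_o.bigI[of "Z + 1"])
    have "Z \<ge> 0" using C E q by (simp add: Z_def)
    thus "Z + 1 > 0" by simp
    have "norm (1 / T * integral {0..T} (\<lambda>t. (cmod (F_lim (Complex \<sigma> t)))\<^sup>2) - diagonal_sum a n \<beta> T) \<le>
        (Z + 1) * norm (sqrt (diagonal_sum a n \<beta> T))" if T: "T \<ge> max T0 (n 0)" for T
    proof -
      define N where "N = T powr (1 / (1 - \<beta>))"
      have T1: "T \<ge> 1" using T T0 by simp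
      have "T powr 1 \<le> N" unfolding N_def using T1 beta by (intro powr_mono) (auto simp: field_simps)
      hence N: "N \<ge> T" using T1 by simp
      have N_pow: "N powr (1 - \<beta>) = T" using T1 beta by (simp add: N_def powr_powr)
      define D where "D = diagonal_sum a n \<beta> T"
      have D: "D = (\<Sum>j | n j \<le> N. (a j)\<^sup>2 * n j powr (- (2 * \<sigma>)))"
      proof -
        have "2 * \<sigma> = 1 + \<beta>" by (simp add: \<sigma>)
        thus ?thesis
          by (simp only: D_def diagonal_sum_def N_def powr_minus_divide times_divide_eq_right mult_1_right)
      qed
      have "(\<Sum>j\<in>{0}. (a j)\<^sup>2 / n j powr (1 + \<beta>)) \<le> D"
        unfolding D_def diagonal_sum_def N_def[symmetric] using T N by (intro sum_mono2) auto
      hence "q \<le> sqrt D" by (simp add: q_def)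
      define r where "r = sqrt D"
      have r: "r \<ge> q" "r > 0" "r\<^sup>2 = D" 
      proof -
        have "sqrt D > 0" using \<open>q \<le> sqrt D\<close> q by linarith
        thus "r \<ge> q" "r > 0" "r\<^sup>2 = D" using \<open>q \<le> sqrt D\<close> by (auto simp: r_def)
      qed
      define IF where "IF = integral {0..T} (\<lambda>t. (cmod (F_lim (Complex \<sigma> t)))\<^sup>2)"
      define IS where "IS = integral {0..T} (\<lambda>t. (cmod (S \<sigma> N t))\<^sup>2)"
      define IV where "IV = integral {0..T} (\<lambda>t. (cmod (F_lim (Complex \<sigma> t) - S \<sigma> N t))\<^sup>2)"
      have cont: "continuous_on X (\<lambda>t. (cmod (F_lim (Complex \<sigma> t)))\<^sup>2)"
        "continuous_on X (\<lambda>t. (cmod (S \<sigma> N t))\<^sup>2)"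
        "continuous_on X (\<lambda>t. (cmod (F_lim (Complex \<sigma> t) - S \<sigma> N t))\<^sup>2)" for X
        unfolding S_def using \<sigma>' by (intro continuous_intros continuous_on_f0_line; simp)+
      note int = cont[THEN integrable_continuous_real, THEN integrable_integral]
      have hF: "((\<lambda>t. (cmod (F_lim (Complex \<sigma> t)))\<^sup>2) has_integral IF) {0..T}"
        and hS: "((\<lambda>t. (cmod (S \<sigma> N t))\<^sup>2) has_integral IS) {0..T}"
        and hV: "((\<lambda>t. (cmod (F_lim (Complex \<sigma> t) - S \<sigma> N t))\<^sup>2) has_integral IV) {0..T}"
        unfolding IF_def IS_def IV_def by (rule int)+
      \<comment> \<open>The choice \<theta> = 1 / r balances the errors: the mean square of
        \<open>S\<close>, about \<open>T * r^2\<close>, is divided by r, while that of the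
        approximation error, O(T), is multiplied by r + 1.\<close>
      have pw: "\<bar>(cmod (F_lim (Complex \<sigma> t)))\<^sup>2 - (cmod (S \<sigma> N t))\<^sup>2\<bar> \<le>
          1 / r * (cmod (S \<sigma> N t))\<^sup>2 + (r + 1) * (cmod (F_lim (Complex \<sigma> t) - S \<sigma> N t))\<^sup>2" for t
        using norm_sq_diff_le[of "1 / r" "F_lim (Complex \<sigma> t)" "S \<sigma> N t"] r by simp
      have "IF - IS \<le> 1 / r * IS + (r + 1) * IV"
        by (rule has_integral_le[OF has_integral_diff[OF hF hS]
              has_integral_add[OF has_integral_mult_right[OF hS] has_integral_mult_right[OF hV]]])
           (use pw abs_le_D1 in blast)
      moreover have "IS - IF \<le> 1 / r * IS + (r + 1) * IV"
        by (rule has_integral_le[OF has_integral_diff[OF hS hF]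
              has_integral_add[OF has_integral_mult_right[OF hS] has_integral_mult_right[OF hV]]])
           (use pw in \<open>smt (verit)\<close>)
      ultimately have FS: "\<bar>IF - IS\<bar> \<le> 1 / r * IS + (r + 1) * IV" by linarith
      have ST: "\<bar>IS - T * D\<bar> \<le> C * T"
      proof -
        have "2 - 2 * \<sigma> = 1 - \<beta>" by (simp add: \<sigma> field_simps)
        hence "N powr (2 - 2 * \<sigma>) = T" by (simp only: N_pow)
        thus ?thesis using S_bound[of N T] N T1 by (simp add: IS_def D)
      qed
      have IV: "IV \<le> E * T" using V_bound[of T] T by (simp add: IV_def N_def)
      have "1 / r * IS \<le> 1 / r * (T * D + C * T)" using ST r by (intro mult_left_mono) auto
      moreover have "(r + 1) * IV \<le> (r + 1) * (E * T)" using IV r by (intro mult_left_mono) auto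
      ultimately have "\<bar>IF - T * D\<bar> \<le> C * T + 1 / r * (T * D + C * T) + (r + 1) * (E * T)"
        using FS ST by linarith
      also have "\<dots> = T * (C + r + C / r + (r + 1) * E)"
        using r(2) unfolding r(3)[symmetric] by (simp add: power2_eq_square field_simps)
      also have "\<dots> \<le> T * (Z * r)"
      proof -
        have "C \<le> C / q * r" using r q C by (simp add: field_simps mult_left_mono)
        moreover have "C / r \<le> C / q\<^sup>2 * r"
        proof -
          have "q\<^sup>2 \<le> r\<^sup>2" using r q by (intro power_mono) auto
          hence "C * q\<^sup>2 \<le> C * r\<^sup>2" using C by (rule mult_left_mono)
          thus ?thesis using r q by (simp add: field_simps power2_eq_square)
        qed
        moreover have "E \<le> E / q * r" using r q E by (simp add: field_simps mult_left_mono)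
        ultimately show ?thesis using T1 by (intro mult_left_mono) (auto simp: Z_def algebra_simps)
      qed
      finally have "\<bar>IF - T * D\<bar> / T \<le> Z * r" using T1 by (simp add: field_simps)
      moreover have "1 / T * IF - D = (IF - T * D) / T" using T1 by (simp add: field_simps)
      ultimately have "\<bar>1 / T * IF - D\<bar> \<le> Z * r" using T1 by simp
      also have "\<dots> \<le> (Z + 1) * r" using r by simp
      finally show ?thesis using r by (simp add: IF_def D_def[symmetric] r_def)
    qed
    thus "eventually (\<lambda>T. norm (1 / T * integral {0..T} (\<lambda>t. (cmod (F_lim (Complex \<sigma> t)))\<^sup>2) - diagonal_sum a n \<beta> T) \<le>
        (Z + 1) * norm (sqrt (diagonal_sum a n \<beta> T))) at_top"
      using eventually_ge_at_top[of "max T0 (n 0)"] by (rule eventually_mono[rotated])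
  qed
qed

end

theorem theorem4p1:
  fixes n a :: "nat \<Rightarrow> real" and \<rho> \<beta> c :: real
  assumes n_pos: "\<And>j. n j > 0"
    and n_strict: "strict_mono n"
    and n_unbounded: "\<not> bdd_above (range n)"
    and a_pos: "\<And>j. a j > 0"
    and rho: "\<rho> > 0"
    and beta: "0 \<le> \<beta>" "\<beta> < 1"
    and A_asymp: "(\<lambda>x. summatory a n x - \<rho> * x) \<in> O[at_top](\<lambda>x. x powr \<beta>)"
    and c: "c > 0"
    and gap: "\<And>j. n (Suc j) - n j \<ge> c * max (a j) (a (Suc j))"
  shows "(\<lambda>T. 1 / T * integral {0..T}
              (\<lambda>t. (cmod (dirichlet_continuation a n \<beta> (Complex ((1 + \<beta>) / 2) t)))\<^sup>2)
            - diagonal_sum a n \<beta> T)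
         \<in> O[at_top](\<lambda>T. sqrt (diagonal_sum a n \<beta> T))"
proof -
  interpret dirichlet_series n a c \<rho> \<beta>
    by unfold_locales fact+
  \<comment> \<open>The abscissa lies strictly between \<beta> and 1, so the line stays inside the
    domain and avoids the pole.\<close>
  have "dirichlet_continuation a n \<beta> (Complex ((1 + \<beta>) / 2) t) = F_lim (Complex ((1 + \<beta>) / 2) t)" for t
    using beta by (intro dirichlet_continuation_eq) (auto simp: complex_eq_iff field_simps)
  thus ?thesis using F_lim_mean_square[OF refl] by simp
qed

end
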